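(* Let $n$ be odd and let $f$ be an $n$-ary quasigroup of order $4$. Then $f$ has at least $8^{n-1}$ transversals.
   Context: Let $\Sigma_q=\{0,\dots,q-1\}$. An $n$-ary quasigroup of order $q$ is a map $f:\Sigma_q^n\to\Sigma_q$ such that the equation $x_0=f(x_1,\dots,x_n)$ has a unique solution in any one of the variables $x_0,\dots,x_n$ when the other $n$ variables are fixed arbitrarily. A transversal in $f$ is a set of $q$ vectors $\alpha^i=(a^i_0,\dots,a^i_n)\in\Sigma_q^{n+1}$, $i=1,\dots,q$, such that $a^i_0=f(a^i_1,\dots,a^i_n)$ for all $i$ and $a^i_k\neq a^j_k$ for all $i\neq j$ and all $k\in\{0,\dots,n\}$. *)

theory Defs
  imports Main
begin

text \<open>
  Elements of \<open>\<Sigma>\<^sub>q\<^sup>m\<close> are lists of length \<open>m\<close>. A vector \<open>(x\<^sub>0, x\<^sub>1, \<dots>, x\<^sub>n)\<close> is a list \<open>\<alpha>\<close> of length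
  \<open>n + 1\<close> with \<open>x\<^sub>k = \<alpha> ! k\<close>, so that \<open>x\<^sub>0 = f(x\<^sub>1, \<dots>, x\<^sub>n)\<close> reads \<open>\<alpha> ! 0 = f (tl \<alpha>)\<close>.
  Values of \<open>f\<close> outside \<open>\<Sigma>\<^sub>q\<^sup>n\<close> are irrelevant.
\<close>

definition words :: "nat \<Rightarrow> nat \<Rightarrow> nat list set" where
  "words q m = {xs. length xs = m \<and> set xs \<subseteq> {0..<q}}"

definition graph_vector :: "(nat list \<Rightarrow> nat) \<Rightarrow> nat list \<Rightarrow> bool" where
  "graph_vector f \<alpha> \<longleftrightarrow> \<alpha> ! 0 = f (tl \<alpha>)"

definition quasigroup :: "nat \<Rightarrow> nat \<Rightarrow> (nat list \<Rightarrow> nat) \<Rightarrow> bool" where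
  "quasigroup q n f \<longleftrightarrow>
     (\<forall>xs \<in> words q n. f xs \<in> {0..<q}) \<and>
     (\<forall>k \<in> {0..n}. \<forall>\<alpha> \<in> words q (n + 1). \<exists>!x. x \<in> {0..<q} \<and> graph_vector f (\<alpha>[k := x]))"

definition transversal :: "nat \<Rightarrow> nat \<Rightarrow> (nat list \<Rightarrow> nat) \<Rightarrow> nat list set \<Rightarrow> bool" where
  "transversal q n f T \<longleftrightarrow>
     T \<subseteq> words q (n + 1) \<and> card T = q \<and>
     (\<forall>\<alpha> \<in> T. graph_vector f \<alpha>) \<and>
     (\<forall>\<alpha> \<in> T. \<forall>\<beta> \<in> T. \<alpha> \<noteq> \<beta> \<longrightarrow> (\<forall>k \<in> {0..n}. \<alpha> ! k \<noteq> \<beta> ! k))"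

end

theory Submission
  imports Defs "HOL-Library.Cardinality" "HOL-Library.FuncSet" "HOL-Combinatorics.Permutations"
begin

text \<open>
  Identify the symbols with the Klein group. Through every point \<open>x\<close> and any two directions \<open>i\<close>,
  \<open>j\<close> passes a Latin square of order 4. Labelling the points of a line by the increments of \<open>f\<close>,
  it becomes one of four normalised squares, described by a colour: \<open>0\<close> for the Klein group,
  \<open>d \<noteq> 0\<close> for the cyclic group with involution \<open>d\<close>. At a fixed \<open>x\<close> the colours contain no rainbow
  triangle. For \<open>b \<noteq> 0\<close> join \<open>i\<close> and \<open>j\<close> if their colour is, at some \<open>x\<close>, different from \<open>0\<close> and
  \<open>b\<close>.

  The key fact is that for some \<open>b\<close> this graph is disconnected. If it is connected for all \<open>b\<close>,
  then the points at which \<open>f\<close> lies in a fixed coset of \<open>{0, b}\<close> are connected by moves that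
  change one coordinate and increase \<open>f\<close> by \<open>b\<close>. Such moves preserve the edges of colour \<open>b\<close>
  between different local components, which carries local information from one point to all
  others; by induction all faces of codimension one are disconnected for the same label \<open>b\<close>, and
  then so is the whole graph.

  If the graph of label \<open>b\<close> has no edges, then \<open>f\<close> is semilinear, and combining affine
  permutations of the coordinates which preserve the cosets of \<open>{0, b}\<close> gives \<open>8 ^ (n - 1)\<close>
  transversals for odd \<open>n\<close>. Otherwise a nontrivial component \<open>W\<close> with complement \<open>J\<close> splits off:
  \<open>f\<close> is a composition \<open>g (h x\<^sub>W, x\<^sub>J)\<close>. If \<open>|W|\<close> is odd, transversals of \<open>h\<close> and \<open>g\<close> are
  combined. If \<open>|W|\<close> is even, one uses families on which \<open>h\<close> is constant: with 4 values and 24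
  matchings they give the factor \<open>96 \<ge> 8\<^sup>2\<close>.
\<close>

section \<open>Latin functions and their faces\<close>

definition face :: "'i set \<Rightarrow> ('i \<Rightarrow> 'v) \<Rightarrow> ('i \<Rightarrow> 'v) set" where
  "face E z = {x. \<forall>i. i \<notin> E \<longrightarrow> x i = z i}"

lemma face_self [simp]: "z \<in> face E z"
  by (simp add: face_def)

lemma face_upd [intro]: "x \<in> face E z \<Longrightarrow> i \<in> E \<Longrightarrow> x(i := v) \<in> face E z"
  by (simp add: face_def)

lemma face_slice_iff: "k \<in> E \<Longrightarrow> x \<in> face (E - {k}) (z(k := v)) \<longleftrightarrow> x k = v \<and> x \<in> face E z"
  by (auto simp: face_def)

lemma face_base_upd: "k \<in> E \<Longrightarrow> face E (z(k := v)) = face E z"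
  by (auto simp: face_def)

lemma face_override_on: "x \<in> face E z \<Longrightarrow> A \<subseteq> E \<Longrightarrow> override_on x y A \<in> face E z"
  by (auto simp: face_def override_on_def)

lemma override_on_face: "y \<in> face E x \<Longrightarrow> override_on x y E = y"
  by (auto simp: face_def override_on_def fun_eq_iff)

lemma face_induct [consumes 3, case_names base upd]:
  assumes "finite E" "x \<in> face E z" "y \<in> face E z"
    and "P x" "\<And>w k v. w \<in> face E z \<Longrightarrow> k \<in> E \<Longrightarrow> P w \<Longrightarrow> P (w(k := v))"
  shows "P y"
proof -
  have "P (override_on x y A)" if "A \<subseteq> E" for A
    using finite_subset [OF that \<open>finite E\<close>] that
    by (induction A rule: finite_induct)
      (use assms in \<open>auto simp: override_on_insert face_override_on\<close>)
  moreover have "override_on x y E = y"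
    using assms by (auto simp: face_def override_on_def fun_eq_iff)
  ultimately show ?thesis
    by (metis subset_refl)
qed

lemma bij_finiteI: "inj s \<Longrightarrow> bij s" for s :: "'v::finite \<Rightarrow> 'v"
  by (simp add: bij_def finite_UNIV_inj_surj)

locale latin =
  fixes f :: "('i \<Rightarrow> 'v::finite) \<Rightarrow> 'v" and I :: "'i set"
  assumes bij_line: "i \<in> I \<Longrightarrow> bij (\<lambda>v. f (x(i := v)))"
begin

definition solve :: "'i \<Rightarrow> 'v \<Rightarrow> ('i \<Rightarrow> 'v) \<Rightarrow> 'v" where
  "solve i u x = (THE v. f (x(i := v)) = u)"

lemma line_eq_iff: "i \<in> I \<Longrightarrow> f (x(i := v)) = f (x(i := w)) \<longleftrightarrow> v = w"
  using bij_line [of i x] by (auto simp: bij_def dest: injD)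

lemma f_solve [simp]:
  assumes "i \<in> I"
  shows "f (x(i := solve i u x)) = u"
proof -
  have "\<exists>v. f (x(i := v)) = u"
    using bij_line [OF assms, of x] by (metis bij_pointE)
  then have "\<exists>!v. f (x(i := v)) = u"
    using line_eq_iff [OF assms] by metis
  then show ?thesis
    unfolding solve_def by (rule theI')
qed

lemma solve_eqI: "i \<in> I \<Longrightarrow> f (x(i := v)) = u \<Longrightarrow> solve i u x = v"
  using f_solve line_eq_iff by metis

lemma latin_subset: "W \<subseteq> I \<Longrightarrow> latin f W"
  by unfold_locales (use bij_line in blast)

lemma latin_solve:
  assumes "k \<in> I"
  shows "latin (solve k u) (I - {k})"
proof
  fix i x assume i: "i \<in> I - {k}"
  show "bij (\<lambda>v. solve k u (x(i := v)))"
  proof (rule bij_finiteI, rule injI)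
    fix v v' assume eq: "solve k u (x(i := v)) = solve k u (x(i := v'))"
    let ?y = "x(k := solve k u (x(i := v)))"
    have "f (?y(i := w)) = u" if "solve k u (x(i := w)) = solve k u (x(i := v))" for w
      using f_solve [OF assms, of "x(i := w)" u] i by (simp add: that fun_upd_twist [of i k])
    then show "v = v'"
      using eq i line_eq_iff [of i ?y v v'] by auto
  qed
qed

end

section \<open>Families of coordinate bijections\<close>

text \<open>A transversal contains exactly one point with value \<open>t\<close> for every \<open>t\<close>, so it is encoded by the
  permutations \<open>\<sigma> i\<close> that send \<open>t\<close> to coordinate \<open>i\<close> of this point: this is the case \<open>g = id\<close>.\<close>

definition bij_families ::
    "(('i \<Rightarrow> 'v) \<Rightarrow> 'v) \<Rightarrow> 'i set \<Rightarrow> ('i \<Rightarrow> 'v) \<Rightarrow> ('v \<Rightarrow> 'v) \<Rightarrow> ('i \<Rightarrow> 'v \<Rightarrow> 'v) set" where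
  "bij_families f E z g =
    {\<sigma> \<in> E \<rightarrow>\<^sub>E {s. bij s}. \<forall>t. f (override_on z (\<lambda>i. \<sigma> i t) E) = g t}"

abbreviation transversal_maps ::
    "(('i \<Rightarrow> 'v) \<Rightarrow> 'v) \<Rightarrow> 'i set \<Rightarrow> ('i \<Rightarrow> 'v) \<Rightarrow> ('i \<Rightarrow> 'v \<Rightarrow> 'v) set" where
  "transversal_maps f E z \<equiv> bij_families f E z id"

lemma bij_familiesD:
  assumes "\<sigma> \<in> bij_families f E z g"
  shows "\<sigma> \<in> E \<rightarrow>\<^sub>E {s. bij s}" "i \<in> E \<Longrightarrow> bij (\<sigma> i)"
    "f (override_on z (\<lambda>i. \<sigma> i t) E) = g t"
  using assms by (auto simp: bij_families_def PiE_def)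

lemma bij_families_eqI:
  assumes "\<sigma> \<in> bij_families f E z g" "\<tau> \<in> bij_families f' E z' g'" "\<And>i. i \<in> E \<Longrightarrow> \<sigma> i = \<tau> i"
  shows "\<sigma> = \<tau>"
  using bij_familiesD(1) [OF assms(1)] bij_familiesD(1) [OF assms(2)] assms(3) by (rule PiE_ext)

lemma finite_bij_families: "finite E \<Longrightarrow> finite (bij_families f E z g)"
  for f :: "('i \<Rightarrow> 'v::finite) \<Rightarrow> 'v"
  unfolding bij_families_def by (intro finite_Collect_conjI disjI1) (auto intro: finite_PiE)

lemma card_bij: "card {s :: 'v::finite \<Rightarrow> 'v. bij s} = fact (CARD('v))"
proof -
  have "{s :: 'v \<Rightarrow> 'v. bij s} = {s. s permutes UNIV}"
    by (auto simp: permutes_def bij_iff)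
  then show ?thesis
    by (simp add: card_permutations)
qed

lemma card_bij_families_comp:
  fixes f :: "('i \<Rightarrow> 'v::finite) \<Rightarrow> 'v"
  assumes "finite W" "bij \<rho>"
  shows "card (bij_families f W z g) \<le> card (bij_families f W z (g \<circ> \<rho>))"
proof (rule card_inj_on_le)
  define \<Phi> where "\<Phi> r = restrict (\<lambda>i. r i \<circ> \<rho>) W" for r :: "'i \<Rightarrow> 'v \<Rightarrow> 'v"
  show "\<Phi> ` bij_families f W z g \<subseteq> bij_families f W z (g \<circ> \<rho>)"
  proof (rule image_subsetI)
    fix r assume r: "r \<in> bij_families f W z g"
    have "override_on z (\<lambda>i. \<Phi> r i t) W = override_on z (\<lambda>i. r i (\<rho> t)) W" for t
      by (auto simp: \<Phi>_def override_on_def)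
    then show "\<Phi> r \<in> bij_families f W z (g \<circ> \<rho>)"
      using bij_familiesD [OF r] assms(2)
      by (auto simp: bij_families_def \<Phi>_def bij_comp)
  qed
  show "inj_on \<Phi> (bij_families f W z g)"
  proof (rule inj_onI)
    fix r r' assume r: "r \<in> bij_families f W z g" "r' \<in> bij_families f W z g" and eq: "\<Phi> r = \<Phi> r'"
    show "r = r'"
    proof (rule bij_families_eqI [OF r])
      fix i assume "i \<in> W"
      then have "r i \<circ> \<rho> = r' i \<circ> \<rho>"
        using fun_cong [OF eq, of i] by (simp add: \<Phi>_def)
      then have "r i (\<rho> t) = r' i (\<rho> t)" for t
        by (metis comp_apply)
      then show "r i = r' i"
        using bij_is_surj [OF assms(2)] by (metis ext surjD)
    qed
  qed
qed (rule finite_bij_families [OF assms(1)])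

context latin
begin

definition constant_family ::
    "'i set \<Rightarrow> 'i \<Rightarrow> ('v \<Rightarrow> 'v) \<Rightarrow> ('i \<Rightarrow> 'v \<Rightarrow> 'v) \<Rightarrow> 'i \<Rightarrow> 'v \<Rightarrow> 'v" where
  "constant_family W k \<rho> r = restrict (\<lambda>i. if i = k then \<rho> else r i \<circ> \<rho>) W"

lemma constant_family_in_bij_families:
  assumes "W \<subseteq> I" "k \<in> W" "bij \<rho>" and r: "r \<in> transversal_maps (solve k u) (W - {k}) z"
  shows "constant_family W k \<rho> r \<in> bij_families f W z (\<lambda>_. u)"
proof -
  have "f (override_on z (\<lambda>i. constant_family W k \<rho> r i t) W) = u" for t
  proof -
    let ?x = "override_on z (\<lambda>i. r i (\<rho> t)) (W - {k})"
    have "override_on z (\<lambda>i. constant_family W k \<rho> r i t) W = ?x(k := solve k u ?x)"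
      using bij_familiesD(3) [OF r, of "\<rho> t"] assms(2)
      by (auto simp: constant_family_def override_on_def fun_eq_iff)
    then show ?thesis
      using assms(1,2) by (simp add: subset_iff)
  qed
  then show ?thesis
    using assms(3) bij_familiesD(2) [OF r]
    by (auto simp: bij_families_def constant_family_def bij_comp)
qed

lemma inj_on_constant_family:
  assumes "k \<in> W"
  shows "inj_on (\<lambda>(\<rho>, r). constant_family W k \<rho> r) ({\<rho>. bij \<rho>} \<times> bij_families g (W - {k}) z h)"
proof (rule inj_onI, clarify)
  fix \<rho> \<rho>' :: "'v \<Rightarrow> 'v" and r r'
  assume \<rho>: "bij \<rho>" and r: "r \<in> bij_families g (W - {k}) z h" "r' \<in> bij_families g (W - {k}) z h"
    and eq: "constant_family W k \<rho> r = constant_family W k \<rho>' r'"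
  have "\<rho> = \<rho>'"
    using fun_cong [OF eq, of k] assms by (simp add: constant_family_def)
  moreover have "r i = r' i" if "i \<in> W - {k}" for i
  proof -
    have "r i (\<rho> t) = r' i (\<rho> t)" for t
      using fun_cong [OF fun_cong [OF eq, of i], of t] that \<open>\<rho> = \<rho>'\<close>
      by (simp add: constant_family_def)
    then show ?thesis
      using bij_is_surj [OF \<rho>] by (metis ext surjD)
  qed
  ultimately show "\<rho> = \<rho>' \<and> r = r'"
    using bij_families_eqI [OF r] by blast
qed

lemma card_bij_families_const:
  assumes "finite W" "W \<subseteq> I" "k \<in> W"
  shows "fact (CARD('v)) * card (transversal_maps (solve k u) (W - {k}) z)
    \<le> card (bij_families f W z (\<lambda>_. u))"
proof -
  have "card ({\<rho> :: 'v \<Rightarrow> 'v. bij \<rho>} \<times> transversal_maps (solve k u) (W - {k}) z)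
      \<le> card (bij_families f W z (\<lambda>_. u))"
    using constant_family_in_bij_families [OF assms(2,3)]
    by (intro card_inj_on_le [OF inj_on_constant_family [OF assms(3)]] finite_bij_families assms(1)) auto
  then show ?thesis
    by (simp add: card_cartesian_product card_bij)
qed

lemma card_transversal_maps_ge_completable:
  assumes "finite E" "k \<in> E" "k \<in> I"
    and "R \<subseteq> (E - {k}) \<rightarrow>\<^sub>E {s. bij s}"
    and "\<And>r. r \<in> R \<Longrightarrow> bij (\<lambda>t. solve k t (override_on z (\<lambda>i. r i t) (E - {k})))"
  shows "card R \<le> card (transversal_maps f E z)"
proof (rule card_inj_on_le)
  define point where "point r t = override_on z (\<lambda>i. r i t) (E - {k})" for r :: "'i \<Rightarrow> 'v \<Rightarrow> 'v" and t
  define \<Phi> where "\<Phi> r = r(k := \<lambda>t. solve k t (point r t))" for r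
  show "\<Phi> ` R \<subseteq> transversal_maps f E z"
  proof (rule image_subsetI)
    fix r assume r: "r \<in> R"
    have "override_on z (\<lambda>i. \<Phi> r i t) E = (point r t)(k := solve k t (point r t))" for t
      using assms(2) by (auto simp: \<Phi>_def point_def override_on_def fun_eq_iff)
    moreover have "\<Phi> r \<in> E \<rightarrow>\<^sub>E {s. bij s}"
      using assms(2,4) assms(5) [OF r] r
      by (auto simp: \<Phi>_def point_def PiE_def Pi_def extensional_def)
    ultimately show "\<Phi> r \<in> transversal_maps f E z"
      using assms(3) by (simp add: bij_families_def)
  qed
  show "inj_on \<Phi> R"
  proof (rule inj_onI)
    fix r r' assume r: "r \<in> R" "r' \<in> R" and eq: "\<Phi> r = \<Phi> r'"
    have "r i = r' i" if "i \<in> E - {k}" for i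
      using fun_cong [OF eq, of i] that by (simp add: \<Phi>_def)
    then show "r = r'"
      using assms(4) r by (intro PiE_ext [of r "E - {k}"]) auto
  qed
qed (rule finite_bij_families [OF assms(1)])

end

section \<open>Splittings\<close>

text \<open>\<open>splits f E z W\<close> says that on the face \<open>f\<close> is a composition \<open>g (h x\<^sub>W, x\<^sub>E\<^sub>-\<^sub>W)\<close>, without
  choosing \<open>g\<close> and \<open>h\<close>.\<close>

definition splits :: "(('i \<Rightarrow> 'v) \<Rightarrow> 'v) \<Rightarrow> 'i set \<Rightarrow> ('i \<Rightarrow> 'v) \<Rightarrow> 'i set \<Rightarrow> bool" where
  "splits f E z W \<longleftrightarrow> (\<forall>x\<in>face E z. \<forall>y\<in>face W x. f x = f y \<longrightarrow>
    (\<forall>w\<in>face E z. f (override_on w x W) = f (override_on w y W)))"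

text \<open>The outer halves of transversals: \<open>g t\<close> is the value of the inner function. Since \<open>g\<close> need not
  be a bijection, the inner half is in general not a transversal.\<close>

definition outer_families :: "(('i \<Rightarrow> 'v) \<Rightarrow> 'v) \<Rightarrow> 'i set \<Rightarrow> ('i \<Rightarrow> 'v) \<Rightarrow> 'i set \<Rightarrow>
    (('v \<Rightarrow> 'v) \<times> ('i \<Rightarrow> 'v \<Rightarrow> 'v)) set" where
  "outer_families f E z W = {(g, s). s \<in> (E - W) \<rightarrow>\<^sub>E {s. bij s} \<and>
    (\<forall>t. \<exists>y\<in>face W z. f y = g t \<and> f (override_on y (\<lambda>i. s i t) (E - W)) = t)}"

definition glue :: "'i set \<Rightarrow> 'i set \<Rightarrow> ('i \<Rightarrow> 'v \<Rightarrow> 'v) \<Rightarrow> ('i \<Rightarrow> 'v \<Rightarrow> 'v) \<Rightarrow> 'i \<Rightarrow> 'v \<Rightarrow> 'v" where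
  "glue E W r s = restrict (override_on s r W) E"

lemma glue_apply: "i \<in> E \<Longrightarrow> glue E W r s i = (if i \<in> W then r i else s i)"
  by (simp add: glue_def override_on_def)

lemma glue_in_transversal_maps:
  assumes "W \<subseteq> E" "splits f E z W" "(g, s) \<in> outer_families f E z W" "r \<in> bij_families f W z g"
  shows "glue E W r s \<in> transversal_maps f E z"
proof -
  have "f (override_on z (\<lambda>i. glue E W r s i t) E) = t" for t
  proof -
    let ?x = "override_on z (\<lambda>i. r i t) W"
    obtain y where y: "y \<in> face W z" "f y = g t" "f (override_on y (\<lambda>i. s i t) (E - W)) = t"
      using assms(3) by (auto simp: outer_families_def)
    let ?w = "override_on y (\<lambda>i. s i t) (E - W)"
    have "?x \<in> face E z" "?w \<in> face E z" "y \<in> face W ?x"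
      using y(1) assms(1) by (auto simp: face_def override_on_def)
    moreover have "f ?x = f y"
      using bij_familiesD(3) [OF assms(4)] y(2) by simp
    ultimately have "f (override_on ?w ?x W) = f (override_on ?w y W)"
      using assms(2) unfolding splits_def by blast
    moreover have "override_on ?w y W = ?w"
      by (auto simp: override_on_def)
    moreover have "override_on ?w ?x W = override_on z (\<lambda>i. glue E W r s i t) E"
      using y(1) assms(1) by (auto simp: override_on_def glue_apply face_def fun_eq_iff)
    ultimately show ?thesis
      using y(3) by simp
  qed
  moreover have "bij (glue E W r s i)" if "i \<in> E" for i
    using assms(3) bij_familiesD(2) [OF assms(4)] that
    by (auto simp: outer_families_def glue_apply)
  ultimately show ?thesis
    by (auto simp: bij_families_def glue_def)
qed

theorem sum_outer_families_le:
  fixes f :: "('i \<Rightarrow> 'v::finite) \<Rightarrow> 'v"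
  assumes "finite E" "W \<subseteq> E" "splits f E z W" "Q \<subseteq> outer_families f E z W"
  shows "(\<Sum>(g, s)\<in>Q. card (bij_families f W z g)) \<le> card (transversal_maps f E z)"
proof -
  define \<Phi> where "\<Phi> = (\<lambda>((g :: 'v \<Rightarrow> 'v, s :: 'i \<Rightarrow> 'v \<Rightarrow> 'v), r). glue E W r s)"
  have "finite (outer_families f E z W)"
  proof (rule finite_subset)
    show "outer_families f E z W \<subseteq> UNIV \<times> ((E - W) \<rightarrow>\<^sub>E {s. bij s})"
      by (auto simp: outer_families_def)
  qed (use assms(1) in \<open>auto intro!: finite_cartesian_product finite_PiE\<close>)
  then have "finite Q" "finite W"
    using assms finite_subset by blast+
  have "card (SIGMA p : Q. bij_families f W z (fst p)) \<le> card (transversal_maps f E z)"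
  proof (rule card_inj_on_le)
    show "\<Phi> ` (SIGMA p : Q. bij_families f W z (fst p)) \<subseteq> transversal_maps f E z"
      using assms(2-4) glue_in_transversal_maps by (fastforce simp: \<Phi>_def)
    show "inj_on \<Phi> (SIGMA p : Q. bij_families f W z (fst p))"
    proof (rule inj_onI, clarsimp simp: \<Phi>_def)
      fix g s r g' s' r'
      assume Q: "(g, s) \<in> Q" "(g', s') \<in> Q" and eq: "glue E W r s = glue E W r' s'"
        and r: "r \<in> bij_families f W z g" "r' \<in> bij_families f W z g'"
      have "s i = s' i" if "i \<in> E - W" for i
        using fun_cong [OF eq, of i] that by (simp add: glue_apply)
      then have "s = s'"
        using Q assms(4) by (intro PiE_ext [of s "E - W"]) (auto simp: outer_families_def)
      moreover have "r i = r' i" if "i \<in> W" for i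
        using fun_cong [OF eq, of i] that assms(2) by (simp add: glue_apply subset_iff)
      then have "r = r'"
        by (rule bij_families_eqI [OF r])
      moreover from this have "g = g'"
        using bij_familiesD(3) [OF r(1)] bij_familiesD(3) [OF r(2)] by fastforce
      ultimately show "g = g' \<and> s = s' \<and> r = r'" by blast
    qed
  qed (rule finite_bij_families [OF assms(1)])
  then show ?thesis
    using \<open>finite Q\<close> \<open>finite W\<close> by (simp add: finite_bij_families case_prod_unfold)
qed

context latin
begin

definition outer_family_of ::
    "'i set \<Rightarrow> 'i \<Rightarrow> ('i \<Rightarrow> 'v) \<Rightarrow> ('i \<Rightarrow> 'v \<Rightarrow> 'v) \<Rightarrow> ('v \<Rightarrow> 'v) \<times> ('i \<Rightarrow> 'v \<Rightarrow> 'v)" where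
  "outer_family_of J k z s = (\<lambda>t. f (z(k := s k t)), restrict s J)"

lemma outer_family_of_in_outer_families:
  assumes "k \<in> W" "s \<in> transversal_maps f (insert k (E - W)) z"
  shows "outer_family_of (E - W) k z s \<in> outer_families f E z W"
proof -
  let ?J = "E - W"
  have "\<exists>y\<in>face W z. f y = f (z(k := s k t)) \<and> f (override_on y (\<lambda>i. restrict s ?J i t) ?J) = t" for t
  proof (rule bexI [of _ "z(k := s k t)"], rule conjI)
    have "override_on (z(k := s k t)) (\<lambda>i. restrict s ?J i t) ?J
        = override_on z (\<lambda>i. s i t) (insert k ?J)"
      using assms(1) by (auto simp: override_on_def)
    then show "f (override_on (z(k := s k t)) (\<lambda>i. restrict s ?J i t) ?J) = t"
      using bij_familiesD(3) [OF assms(2)] by simp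
  qed (use assms(1) in auto)
  then show ?thesis
    using bij_familiesD(2) [OF assms(2)] by (simp add: outer_family_of_def outer_families_def)
qed

lemma inj_on_outer_family_of:
  assumes "k \<in> I"
  shows "inj_on (outer_family_of J k z) (bij_families f (insert k J) z g)"
proof (rule inj_onI)
  fix s s'
  assume s: "s \<in> bij_families f (insert k J) z g" "s' \<in> bij_families f (insert k J) z g"
    and eq: "outer_family_of J k z s = outer_family_of J k z s'"
  have "s i = s' i" if "i \<in> insert k J" for i
  proof (cases "i = k")
    case True
    then show ?thesis
      using eq assms by (auto simp: outer_family_of_def fun_eq_iff line_eq_iff)
  next
    case False
    then show ?thesis
      using eq that by (auto simp: outer_family_of_def dest!: fun_cong [of _ _ i])
  qed
  then show "s = s'"
    by (rule bij_families_eqI [OF s])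
qed

lemma card_transversal_maps_splits_product:
  assumes "finite E" "W \<subseteq> E" "splits f E z W" "k \<in> W" "k \<in> I"
  shows "card (transversal_maps f W z) * card (transversal_maps f (insert k (E - W)) z)
    \<le> card (transversal_maps f E z)"
proof -
  let ?S = "transversal_maps f (insert k (E - W)) z" and ?h = "outer_family_of (E - W) k z"
  have "card (transversal_maps f W z) \<le> card (bij_families f W z (fst (?h s)))" if "s \<in> ?S" for s
  proof -
    have "bij (fst (?h s))"
      using bij_comp [OF bij_familiesD(2) [OF that, of k] bij_line [OF \<open>k \<in> I\<close>, of z]]
      by (simp add: outer_family_of_def comp_def)
    then show ?thesis
      using card_bij_families_comp [OF finite_subset [OF assms(2,1)], of _ f z id] by simp
  qed
  then have "card ?S * card (transversal_maps f W z)
      \<le> (\<Sum>s\<in>?S. card (bij_families f W z (fst (?h s))))"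
    using sum_bounded_below [of ?S "card (transversal_maps f W z)"] by simp
  also have "\<dots> = (\<Sum>(g, s)\<in>?h ` ?S. card (bij_families f W z g))"
    by (subst sum.reindex [OF inj_on_outer_family_of [OF assms(5)]]) (simp add: case_prod_unfold)
  also have "\<dots> \<le> card (transversal_maps f E z)"
    using outer_family_of_in_outer_families [OF assms(4)]
    by (intro sum_outer_families_le [OF assms(1-3)]) blast
  finally show ?thesis
    by (simp add: mult.commute)
qed

lemma card_transversal_maps_splits_const:
  assumes "finite E" "W \<subseteq> E" "W \<subseteq> I" "splits f E z W" "k \<in> W"
    and inner: "\<And>u. m \<le> card (transversal_maps (solve k u) (W - {k}) z)"
    and outer: "\<And>y. n \<le> card (transversal_maps f (E - W) y)"
  shows "CARD('v) * (fact CARD('v) * m * n) \<le> card (transversal_maps f E z)"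
proof -
  define y where "y u = z(k := solve k u z)" for u
  define T where "T u = transversal_maps f (E - W) (y u)" for u
  define Q where "Q = (\<lambda>(u, s). (\<lambda>_ :: 'v. u, s)) ` (SIGMA u : UNIV. T u)"
  have "fact CARD('v) * m \<le> card (bij_families f W z (\<lambda>_. u))" for u
    using mult_le_mono2 [OF inner [of u]]
      card_bij_families_const [OF finite_subset [OF assms(2,1)] assms(3,5)]
    by (rule le_trans)
  then have "fact CARD('v) * m * n \<le> card (bij_families f W z (\<lambda>_. u)) * card (T u)" for u
    unfolding T_def using outer by (rule mult_le_mono)
  then have "CARD('v) * (fact CARD('v) * m * n)
      \<le> (\<Sum>u\<in>UNIV. card (bij_families f W z (\<lambda>_. u)) * card (T u))"
    using sum_bounded_below [of "UNIV :: 'v set" "fact CARD('v) * m * n"] by simp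
  also have "\<dots> = (\<Sum>u\<in>UNIV. \<Sum>s\<in>T u. card (bij_families f W z (\<lambda>_. u)))"
    by (simp add: mult.commute)
  also have "\<dots> = (\<Sum>(u, s)\<in>(SIGMA u : UNIV. T u). card (bij_families f W z (\<lambda>_. u)))"
    using assms(1) by (intro sum.Sigma) (simp_all add: T_def finite_bij_families)
  also have "\<dots> = (\<Sum>(g, s)\<in>Q. card (bij_families f W z g))"
    unfolding Q_def by (subst sum.reindex) (auto simp: inj_on_def fun_eq_iff case_prod_unfold)
  also have "\<dots> \<le> card (transversal_maps f E z)"
  proof (rule sum_outer_families_le [OF assms(1,2,4)])
    have "f (y u) = u" "y u \<in> face W z" for u
      using assms(3,5) by (auto simp: y_def)
    then show "Q \<subseteq> outer_families f E z W"
      using bij_familiesD [where E = "E - W"] by (fastforce simp: Q_def T_def outer_families_def)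
  qed
  finally show ?thesis .
qed

end

section \<open>The Klein group and Latin squares of order 4\<close>

datatype klein4 = K0 | K1 | K2 | K3

instantiation klein4 :: ab_group_add
begin

definition zero_klein4 :: klein4 where "zero_klein4 = K0"

definition uminus_klein4 :: "klein4 \<Rightarrow> klein4" where "uminus_klein4 a = a"

fun plus_klein4 :: "klein4 \<Rightarrow> klein4 \<Rightarrow> klein4" where
  "plus_klein4 K0 b = b"
| "plus_klein4 a K0 = a"
| "plus_klein4 K1 K1 = K0" | "plus_klein4 K1 K2 = K3" | "plus_klein4 K1 K3 = K2"
| "plus_klein4 K2 K1 = K3" | "plus_klein4 K2 K2 = K0" | "plus_klein4 K2 K3 = K1"
| "plus_klein4 K3 K1 = K2" | "plus_klein4 K3 K2 = K1" | "plus_klein4 K3 K3 = K0"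

definition minus_klein4 :: "klein4 \<Rightarrow> klein4 \<Rightarrow> klein4" where "minus_klein4 a b = a + b"

instance
proof
  fix a b c :: klein4
  show "a + b + c = a + (b + c)" by (cases a; cases b; cases c) simp_all
  show "a + b = b + a" by (cases a; cases b) simp_all
  show "0 + a = a" by (cases a) (simp_all add: zero_klein4_def)
  show "- a + a = 0" by (cases a) (simp_all add: zero_klein4_def uminus_klein4_def)
  show "a - b = a + - b" by (simp add: minus_klein4_def uminus_klein4_def)
qed

end

lemma UNIV_klein4: "UNIV = {K0, K1, K2, K3}"
  using klein4.exhaust by blast

instantiation klein4 :: enum
begin

definition "enum_klein4 = [K0, K1, K2, K3]"

definition "enum_all_klein4 P \<longleftrightarrow> P K0 \<and> P K1 \<and> P K2 \<and> P K3"

definition "enum_ex_klein4 P \<longleftrightarrow> P K0 \<or> P K1 \<or> P K2 \<or> P K3"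

instance
  by standard
    (simp_all only: enum_klein4_def enum_all_klein4_def enum_ex_klein4_def UNIV_klein4, simp_all)

end

lemma card_klein4: "CARD(klein4) = 4"
  by (simp add: UNIV_klein4)

lemma klein4_add_self [simp]: "a + a = 0" for a :: klein4
  by (cases a) (simp_all add: zero_klein4_def)

lemma klein4_add_self_left [simp]: "a + (a + b) = b" for a b :: klein4
  by (simp add: add.assoc [symmetric])

lemma klein4_add_eq_0_iff [simp]: "a + b = 0 \<longleftrightarrow> a = b" for a b :: klein4
  by (metis add.right_neutral klein4_add_self klein4_add_self_left)

text \<open>For \<open>b \<noteq> 0\<close> this is the linear functional on \<open>\<bbbZ>\<^sub>2 \<times> \<bbbZ>\<^sub>2\<close> with kernel \<open>{0, b}\<close>.\<close>

definition outside :: "klein4 \<Rightarrow> klein4 \<Rightarrow> bool" where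
  "outside b v \<longleftrightarrow> v \<noteq> 0 \<and> v \<noteq> b"

lemma outside_add: "b \<noteq> 0 \<Longrightarrow> outside b (u + v) \<longleftrightarrow> outside b u \<noteq> outside b v"
  by (cases b; cases u; cases v) (simp_all add: outside_def zero_klein4_def)

lemma outside_0 [simp]: "\<not> outside b 0"
  by (simp add: outside_def)

lemma outside_self [simp]: "\<not> outside b b"
  by (simp add: outside_def)

lemma ex_outside: "\<exists>c. outside b c"
  by (cases b) (auto simp: outside_def zero_klein4_def intro: exI [of _ K1] exI [of _ K2])

lemma not_outside_add_cases: "\<not> outside b (u + v) \<Longrightarrow> v = u \<or> v = u + b"
  by (metis outside_def klein4_add_eq_0_iff klein4_add_self_left)

text \<open>The four normalised Latin squares of order 4: \<open>square 0\<close> is the Klein group, and \<open>square d\<close> for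
  \<open>d \<noteq> 0\<close> is the cyclic group in which \<open>d\<close> is the element of order 2.\<close>

definition square :: "klein4 \<Rightarrow> klein4 \<Rightarrow> klein4 \<Rightarrow> klein4" where
  "square d a b = (if d \<noteq> 0 \<and> outside d a \<and> outside d b then a + b + d else a + b)"

definition twist :: "klein4 \<Rightarrow> klein4 \<Rightarrow> klein4 \<Rightarrow> klein4" where
  "twist d c b = square d c b + c"

lemma square_commute: "square d a b = square d b a"
  by (simp add: square_def add.commute conj_commute)

lemma square_0 [simp]: "square d a 0 = a" "square d 0 b = b"
  by (simp_all add: square_def)

lemma twist_twist [simp]: "twist d c (twist d c b) = b"
proof -
  have "\<forall>d c b. twist d c (twist d c b) = b"
    by code_simp
  then show ?thesis by blast
qed

lemma square_add_left: "square d (a + c) b = c + square d a (twist d c b)"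
proof -
  have "\<forall>d a c b. square d (a + c) b = c + square d a (twist d c b)"
    by code_simp
  then show ?thesis by blast
qed

lemma inj_square: "inj square"
proof (rule injI)
  fix d d' assume eq: "square d = square d'"
  have "\<forall>d d'. (\<forall>a b. square d a b = square d' a b) \<longrightarrow> d = d'"
    by code_simp
  then show "d = d'"
    using eq by simp
qed

lemma normalised_row_eq_square:
  assumes "inj R" "R 0 = a" "a \<noteq> 0" "\<And>b. R b \<noteq> b"
  shows "\<exists>d. d \<noteq> a \<and> R = square d a"
proof -
  have "\<forall>a p q r. a \<noteq> 0 \<longrightarrow> distinct [a, p, q, r] \<longrightarrow> p \<noteq> K1 \<longrightarrow> q \<noteq> K2 \<longrightarrow> r \<noteq> K3 \<longrightarrow>
      (\<exists>d. d \<noteq> a \<and> p = square d a K1 \<and> q = square d a K2 \<and> r = square d a K3)"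
    by code_simp
  moreover have "distinct [a, R K1, R K2, R K3]"
    using inj_eq [OF \<open>inj R\<close>] assms(2) by (auto simp: zero_klein4_def)
  ultimately obtain d
    where d: "d \<noteq> a" "R K1 = square d a K1" "R K2 = square d a K2" "R K3 = square d a K3"
    using assms(3,4) by meson
  have "R b = square d a b" for b
    using d(2-) assms(2) square_0(1) [of d a] by (cases b) (simp_all add: zero_klein4_def)
  then show ?thesis
    using d(1) by blast
qed

lemma latin_square_normal_form:
  assumes "\<And>a. L a 0 = a" "\<And>b. L 0 b = b" "\<And>a. inj (L a)" "\<And>b. inj (\<lambda>a. L a b)"
  shows "\<exists>d. L = square d"
proof -
  have clash: "L a b \<noteq> L a' b" if "a \<noteq> a'" for a a' b
    using injD [OF assms(4)] that by blast
  have "\<forall>a. \<exists>d. a \<noteq> 0 \<longrightarrow> d \<noteq> a \<and> L a = square d a"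
    using normalised_row_eq_square [OF assms(3,1)] clash assms(2) by metis
  then obtain \<delta> where \<delta>: "\<And>a. a \<noteq> 0 \<Longrightarrow> \<delta> a \<noteq> a" "\<And>a. a \<noteq> 0 \<Longrightarrow> L a = square (\<delta> a) a"
    by metis
  have "\<forall>d1 d2 d3. d1 \<noteq> K1 \<longrightarrow> d2 \<noteq> K2 \<longrightarrow> d3 \<noteq> K3 \<longrightarrow>
      (\<forall>b. distinct [square d1 K1 b, square d2 K2 b, square d3 K3 b]) \<longrightarrow>
      (\<exists>d. \<forall>b. square d1 K1 b = square d K1 b \<and> square d2 K2 b = square d K2 b \<and>
        square d3 K3 b = square d K3 b)"
    by code_simp
  moreover have "distinct [square (\<delta> K1) K1 b, square (\<delta> K2) K2 b, square (\<delta> K3) K3 b]" for b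
    using clash \<delta>(2) by (auto simp: zero_klein4_def simp flip: \<delta>(2))
  ultimately obtain d where d: "\<And>b. L K1 b = square d K1 b" "\<And>b. L K2 b = square d K2 b"
      "\<And>b. L K3 b = square d K3 b"
    using \<delta> by (metis klein4.distinct(1,3,5) zero_klein4_def)
  have "L a b = square d a b" for a b
    using d assms(2) by (cases a) (simp_all flip: zero_klein4_def)
  then show ?thesis by blast
qed

text \<open>Here \<open>d\<close>, \<open>d1\<close>, \<open>d2\<close> are the types of the three Latin squares through a point of a Latin cube,
  and \<open>e\<close> is the type of the square parallel to the first one at height \<open>t\<close>. In a cube these two
  parallel squares have no common value on any vertical line.\<close>

definition slices_disjoint :: "klein4 \<Rightarrow> klein4 \<Rightarrow> klein4 \<Rightarrow> klein4 \<Rightarrow> klein4 \<Rightarrow> bool" where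
  "slices_disjoint d d1 d2 t e \<longleftrightarrow>
     (\<forall>a b. square d a b \<noteq> t + square e (twist d1 t a) (twist d2 t b))"

text \<open>If the three types were distinct, the height below would be nonzero and no \<open>e\<close> would fit.\<close>

lemma slices_disjoint_not_rainbow:
  assumes "slices_disjoint d d1 d2 (if d + d1 + d2 = 0 then d else d + d1 + d2) e"
  shows "d = d1 \<or> d = d2 \<or> d1 = d2"
proof -
  have "\<forall>d d1 d2 e. slices_disjoint d d1 d2 (if d + d1 + d2 = 0 then d else d + d1 + d2) e \<longrightarrow>
    d = d1 \<or> d = d2 \<or> d1 = d2"
    by code_simp
  then show ?thesis
    using assms by blast
qed

lemma slices_disjoint_toggle:
  assumes "slices_disjoint d c c t e" "c \<noteq> 0" "outside c d" "outside c t"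
  shows "e = c + d"
proof -
  have "\<forall>d c t e. slices_disjoint d c c t e \<longrightarrow> c \<noteq> 0 \<longrightarrow> outside c d \<longrightarrow> outside c t \<longrightarrow> e = c + d"
    by code_simp
  then show ?thesis
    using assms by blast
qed

lemma slices_disjoint_stable:
  assumes "slices_disjoint c c d t e" "c \<noteq> 0" "outside c d" "t \<noteq> 0"
  shows "e = c \<or> e = 0"
proof -
  have "\<forall>c d t e. slices_disjoint c c d t e \<longrightarrow> c \<noteq> 0 \<longrightarrow> outside c d \<longrightarrow> t \<noteq> 0 \<longrightarrow> e = c \<or> e = 0"
    by code_simp
  then show ?thesis
    using assms by blast
qed

lemma slices_disjoint_persist:
  assumes "slices_disjoint b d1 d2 b e" "b \<noteq> 0" "\<not> outside b d1 \<or> \<not> outside b d2"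
  shows "e = b"
proof -
  have "\<forall>b d1 d2 e. slices_disjoint b d1 d2 b e \<longrightarrow> b \<noteq> 0 \<longrightarrow>
    \<not> outside b d1 \<or> \<not> outside b d2 \<longrightarrow> e = b"
    by code_simp
  then show ?thesis
    using assms by blast
qed

section \<open>Moves and colours\<close>

locale latin4 = latin f I for f :: "('i \<Rightarrow> klein4) \<Rightarrow> klein4" and I
begin

definition move_val :: "'i \<Rightarrow> klein4 \<Rightarrow> ('i \<Rightarrow> klein4) \<Rightarrow> klein4" where
  "move_val i a x = solve i (f x + a) x"

definition move :: "'i \<Rightarrow> klein4 \<Rightarrow> ('i \<Rightarrow> klein4) \<Rightarrow> 'i \<Rightarrow> klein4" where
  "move i a x = x(i := move_val i a x)"

lemma f_move_val [simp]: "i \<in> I \<Longrightarrow> f (x(i := move_val i a x)) = f x + a"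
  by (simp add: move_val_def)

lemma move_val_eqI: "i \<in> I \<Longrightarrow> f (x(i := v)) = f x + a \<Longrightarrow> move_val i a x = v"
  by (simp add: move_val_def solve_eqI)

lemma f_move [simp]: "i \<in> I \<Longrightarrow> f (move i a x) = f x + a"
  by (simp add: move_def)

lemma upd_eq_move: "i \<in> I \<Longrightarrow> x(i := v) = move i (f x + f (x(i := v))) x"
  by (simp add: move_def move_val_eqI)

lemma move_val_move_same: "i \<in> I \<Longrightarrow> move_val i a (move i c x) = move_val i (c + a) x"
  by (rule move_val_eqI) (simp_all add: move_def ac_simps)

lemma move_move [simp]: "i \<in> I \<Longrightarrow> move i a (move i c x) = move i (c + a) x"
  by (subst move_def) (simp add: move_val_move_same, simp add: move_def)

lemma move_0 [simp]: "i \<in> I \<Longrightarrow> move i 0 x = x"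
  using upd_eq_move [of i x "x i"] by simp

lemma move_val_eq_iff: "i \<in> I \<Longrightarrow> move_val i a x = move_val i b x \<longleftrightarrow> a = b"
  by (metis f_move_val add_left_cancel)

lemma ex_move_val: "i \<in> I \<Longrightarrow> \<exists>a. v = move_val i a x"
  by (metis fun_upd_same move_def upd_eq_move)

abbreviation plane_point :: "'i \<Rightarrow> 'i \<Rightarrow> ('i \<Rightarrow> klein4) \<Rightarrow> klein4 \<Rightarrow> klein4 \<Rightarrow> 'i \<Rightarrow> klein4" where
  "plane_point i j x a b \<equiv> x(i := move_val i a x, j := move_val j b x)"

lemma plane_point_commute: "i \<noteq> j \<Longrightarrow> plane_point i j x a b = plane_point j i x b a"
  by (rule fun_upd_twist)

lemma ex1_square_plane:
  assumes "i \<in> I" "j \<in> I" "i \<noteq> j"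
  shows "\<exists>!d. \<forall>a b. f (plane_point i j x a b) = f x + square d a b"
proof -
  define L where "L a b = f x + f (plane_point i j x a b)" for a b
  have move_val_0: "move_val k 0 x = x k" if "k \<in> I" for k
    using that by (intro move_val_eqI) simp_all
  have "\<exists>d. L = square d"
  proof (rule latin_square_normal_form)
    have "x(i := v, j := x j) = x(i := v)" for v
      using assms by (auto simp: fun_eq_iff)
    then show "L a 0 = a" for a
      using assms by (simp add: L_def move_val_0)
    show "L 0 b = b" for b
      using assms by (simp add: L_def move_val_0)
    show "inj (L a)" for a
      using assms by (auto simp: inj_def L_def line_eq_iff move_val_eq_iff)
    show "inj (\<lambda>a. L a b)" for b
      using assms
      by (auto simp: inj_def L_def plane_point_commute [of i j] line_eq_iff move_val_eq_iff)
  qed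
  then obtain d where "L = square d" ..
  then have d: "f (plane_point i j x a b) = f x + square d a b" for a b
    by (metis L_def klein4_add_self_left)
  show ?thesis
  proof (rule ex1I [of _ d])
    show "d' = d" if "\<forall>a b. f (plane_point i j x a b) = f x + square d' a b" for d'
    proof (rule injD [OF inj_square], intro ext)
      show "square d' a b = square d a b" for a b
        using that d by (metis add_left_cancel)
    qed
  qed (simp add: d)
qed

definition colour :: "'i \<Rightarrow> 'i \<Rightarrow> ('i \<Rightarrow> klein4) \<Rightarrow> klein4" where
  "colour i j x = (THE d. \<forall>a b. f (plane_point i j x a b) = f x + square d a b)"

lemma f_plane_point:
  assumes "i \<in> I" "j \<in> I" "i \<noteq> j"
  shows "f (plane_point i j x a b) = f x + square (colour i j x) a b"
  using theI' [OF ex1_square_plane [OF assms]] unfolding colour_def by blast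

lemma colour_eqI:
  assumes "i \<in> I" "j \<in> I" "i \<noteq> j"
    and "\<And>a b. f (plane_point i j x a b) = f x + square d a b"
  shows "colour i j x = d"
  unfolding colour_def using assms(4)
  by (intro the1_equality [OF ex1_square_plane [OF assms(1-3)]]) blast

lemma colour_sym:
  assumes "i \<in> I" "j \<in> I" "i \<noteq> j"
  shows "colour i j x = colour j i x"
proof (rule colour_eqI [OF assms])
  show "f (plane_point i j x a b) = f x + square (colour j i x) a b" for a b
    using f_plane_point [of j i x b a] assms by (simp add: fun_upd_twist square_commute)
qed

lemma move_val_move_twist:
  assumes "i \<in> I" "j \<in> I" "i \<noteq> j"
  shows "move_val j (twist (colour i j x) c b) (move i c x) = move_val j b x"
proof (rule move_val_eqI [OF assms(2)])
  have "f ((move i c x)(j := move_val j b x)) = f x + square (colour i j x) c b"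
    using f_plane_point [OF assms, of x c b] by (simp add: move_def)
  then show "f ((move i c x)(j := move_val j b x)) = f (move i c x) + twist (colour i j x) c b"
    using assms by (simp add: twist_def ac_simps)
qed

lemma move_val_move:
  assumes "i \<in> I" "j \<in> I" "i \<noteq> j"
  shows "move_val j b (move i c x) = move_val j (twist (colour i j x) c b) x"
  using move_val_move_twist [OF assms, of x c "twist (colour i j x) c b"] by simp

lemma move_commute:
  assumes "i \<in> I" "j \<in> I" "i \<noteq> j" "d = colour i j x"
  shows "move j b (move i c x) = move i (twist d (twist d c b) c) (move j (twist d c b) x)"
proof -
  have "move j b (move i c x) = plane_point i j x c (twist d c b)"
    using assms by (simp add: move_def [of j] move_val_move) (simp add: move_def)
  also have "\<dots> = move i (twist d (twist d c b) c) (move j (twist d c b) x)"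
    using assms colour_sym [OF assms(1-3), of x]
    by (simp add: move_def [of i] move_val_move fun_upd_twist) (simp add: move_def fun_upd_twist)
  finally show ?thesis .
qed

lemma colour_move_left:
  assumes "i \<in> I" "j \<in> I" "i \<noteq> j"
  shows "colour i j (move i c x) = colour i j x"
proof (rule colour_eqI [OF assms])
  fix a b
  have "f (plane_point i j (move i c x) a b)
      = f (plane_point i j x (c + a) (twist (colour i j x) c b))"
    using assms by (simp add: move_val_move_same move_val_move) (simp add: move_def)
  also have "\<dots> = f x + square (colour i j x) (a + c) (twist (colour i j x) c b)"
    using f_plane_point [OF assms] by (simp add: add.commute)
  also have "\<dots> = f (move i c x) + square (colour i j x) a b"
    using assms by (simp add: square_add_left ac_simps)
  finally show "f (plane_point i j (move i c x) a b)
      = f (move i c x) + square (colour i j x) a b" .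
qed

lemma colour_upd [simp]:
  assumes "i \<in> I" "j \<in> I" "i \<noteq> j"
  shows "colour i j (x(i := v)) = colour i j x" "colour i j (x(j := v)) = colour i j x"
proof -
  show "colour i j (x(i := v)) = colour i j x"
    using assms by (subst upd_eq_move) (simp_all add: colour_move_left)
  have "colour j i (x(j := v)) = colour j i x"
    using assms by (subst upd_eq_move) (simp_all add: colour_move_left)
  then show "colour i j (x(j := v)) = colour i j x"
    using assms by (simp add: colour_sym)
qed

lemma colour_move [simp]:
  assumes "i \<in> I" "j \<in> I" "i \<noteq> j"
  shows "colour i j (move i c x) = colour i j x" "colour i j (move j c x) = colour i j x"
  using assms by (simp_all add: move_def)

lemma slices_disjoint_colour:
  assumes ijk: "i \<in> I" "j \<in> I" "k \<in> I" "i \<noteq> j" "i \<noteq> k" "j \<noteq> k" and "t \<noteq> 0"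
  shows "slices_disjoint (colour i j x) (colour i k x) (colour j k x) t (colour i j (move k t x))"
  unfolding slices_disjoint_def
proof (intro allI notI)
  fix a b
  assume clash: "square (colour i j x) a b
    = t + square (colour i j (move k t x)) (twist (colour i k x) t a) (twist (colour j k x) t b)"
  let ?y = "move k t x" and ?w = "plane_point i j x a b"
  have "f (?w(k := move_val k t x)) = f (?y(i := move_val i a x, j := move_val j b x))"
    using ijk by (simp add: move_def fun_upd_twist)
  also have "\<dots> = f (plane_point i j ?y (twist (colour i k x) t a) (twist (colour j k x) t b))"
    using ijk colour_sym [of i k x] colour_sym [of j k x] by (simp add: move_val_move)
  also have "\<dots> = f x + t + square (colour i j ?y) (twist (colour i k x) t a) (twist (colour j k x) t b)"
    using ijk by (simp add: f_plane_point)
  also have "\<dots> = f x + square (colour i j x) a b"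
    by (simp add: clash ac_simps)
  also have "\<dots> = f (?w(k := x k))"
    using ijk by (simp add: f_plane_point fun_upd_twist)
  finally have "move_val k t x = x k"
    using ijk by (simp add: line_eq_iff)
  then have "move_val k t x = move_val k 0 x"
    using ijk move_0 [of k x] by (metis fun_upd_same move_def)
  then show False
    using ijk \<open>t \<noteq> 0\<close> by (simp add: move_val_eq_iff)
qed

lemma colour_not_rainbow:
  assumes "i \<in> I" "j \<in> I" "k \<in> I" "i \<noteq> j" "i \<noteq> k" "j \<noteq> k"
  shows "colour i j x = colour i k x \<or> colour i j x = colour j k x \<or> colour i k x = colour j k x"
proof (rule ccontr)
  let ?d = "colour i j x" and ?d1 = "colour i k x" and ?d2 = "colour j k x"
  assume rainbow: "\<not> ?thesis"
  let ?t = "if ?d + ?d1 + ?d2 = 0 then ?d else ?d + ?d1 + ?d2"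
  have "?t \<noteq> 0"
    using rainbow by (auto split: if_splits)
  then show False
    using slices_disjoint_not_rainbow [OF slices_disjoint_colour [OF assms, of ?t x]] rainbow
    by auto
qed

lemma colour_move_toggle:
  assumes "i \<in> I" "j \<in> I" "k \<in> I" "i \<noteq> j" "i \<noteq> k" "j \<noteq> k"
    and "colour i k x = c" "colour j k x = c" "c \<noteq> 0" "outside c (colour i j x)" "outside c t"
  shows "colour i j (move k t x) = c + colour i j x"
  using slices_disjoint_colour [OF assms(1-6), of t x] slices_disjoint_toggle assms(7-)
  by (auto simp: outside_def)

lemma colour_move_stable:
  assumes "i \<in> I" "j \<in> I" "k \<in> I" "i \<noteq> j" "i \<noteq> k" "j \<noteq> k"
    and "colour i j x = c" "colour i k x = c" "c \<noteq> 0" "outside c (colour j k x)"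
  shows "colour i j (move k t x) = c"
proof (cases "t = 0")
  case False
  have "colour i j (move k t x) = c \<or> colour i j (move k t x) = 0"
    using slices_disjoint_colour [OF assms(1-6) False, of x] slices_disjoint_stable assms(7-) False
    by (auto simp: outside_def)
  moreover have "colour i k (move k t x) = c" "colour j k (move k t x) = colour j k x"
    using assms by simp_all
  ultimately show ?thesis
    using colour_not_rainbow [OF assms(1-6), of "move k t x"] assms(9,10)
    by (auto simp: outside_def)
qed (use assms in simp)

lemma colour_move_persist:
  assumes "i \<in> I" "j \<in> I" "k \<in> I" "i \<noteq> j"
    and "colour i j x = b" "b \<noteq> 0"
    and "i \<noteq> k \<Longrightarrow> j \<noteq> k \<Longrightarrow> \<not> outside b (colour i k x) \<or> \<not> outside b (colour j k x)"
  shows "colour i j (move k b x) = b"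
proof (cases "i = k \<or> j = k")
  case False
  then show ?thesis
    using slices_disjoint_colour [of i j k b x] slices_disjoint_persist assms by auto
qed (use assms in auto)

end

section \<open>Connected components of a relation\<close>

definition rel_separated :: "('i \<Rightarrow> 'i \<Rightarrow> bool) \<Rightarrow> 'i set \<Rightarrow> 'i set \<Rightarrow> bool" where
  "rel_separated R Y A \<longleftrightarrow> A \<subseteq> Y \<and> (\<forall>i\<in>A. \<forall>j\<in>Y - A. \<not> R i j)"

definition rel_connected :: "('i \<Rightarrow> 'i \<Rightarrow> bool) \<Rightarrow> 'i set \<Rightarrow> bool" where
  "rel_connected R Y \<longleftrightarrow> (\<forall>A. rel_separated R Y A \<longrightarrow> A = {} \<or> A = Y)"

definition rel_component :: "('i \<Rightarrow> 'i \<Rightarrow> bool) \<Rightarrow> 'i set \<Rightarrow> 'i \<Rightarrow> 'i set" where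
  "rel_component R Y i = {j. (\<lambda>u v. u \<in> Y \<and> v \<in> Y \<and> R u v)\<^sup>*\<^sup>* i j}"

lemma rel_connectedE:
  assumes "rel_connected R Y" "A \<subseteq> Y" "A \<noteq> {}" "A \<noteq> Y"
  obtains i j where "i \<in> A" "j \<in> Y" "j \<notin> A" "R i j"
  using assms unfolding rel_connected_def rel_separated_def by blast

lemma rel_connected_mono:
  assumes "rel_connected R Y" "\<And>i j. i \<in> Y \<Longrightarrow> j \<in> Y \<Longrightarrow> R i j \<Longrightarrow> S i j"
  shows "rel_connected S Y"
  using assms unfolding rel_connected_def rel_separated_def by (metis DiffD1 in_mono)

lemma rel_connected_empty: "rel_connected R {}"
  by (simp add: rel_connected_def rel_separated_def)

lemma rel_connected_singleton: "rel_connected R {i}"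
  by (auto simp: rel_connected_def rel_separated_def)

lemma rel_component_self [simp]: "i \<in> rel_component R Y i"
  by (simp add: rel_component_def)

lemma rel_component_step:
  "j \<in> rel_component R Y i \<Longrightarrow> j \<in> Y \<Longrightarrow> k \<in> Y \<Longrightarrow> R j k \<Longrightarrow> k \<in> rel_component R Y i"
  unfolding rel_component_def by (auto intro: rtranclp.rtrancl_into_rtrancl)

lemma rel_component_induct [consumes 1, case_names base step]:
  assumes "j \<in> rel_component R Y i" "P i"
    and "\<And>u v. u \<in> rel_component R Y i \<Longrightarrow> u \<in> Y \<Longrightarrow> v \<in> Y \<Longrightarrow> R u v \<Longrightarrow> P u \<Longrightarrow> P v"
  shows "P j"
proof -
  have "(\<lambda>u v. u \<in> Y \<and> v \<in> Y \<and> R u v)\<^sup>*\<^sup>* i j"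
    using assms(1) by (simp add: rel_component_def)
  then show ?thesis
    by induction (use assms(2,3) in \<open>auto simp: rel_component_def\<close>)
qed

lemma rel_component_subset: "i \<in> Y \<Longrightarrow> rel_component R Y i \<subseteq> Y"
  by (auto elim: rel_component_induct)

lemma rel_component_eq:
  assumes sym: "\<And>u v. u \<in> Y \<Longrightarrow> v \<in> Y \<Longrightarrow> R u v \<Longrightarrow> R v u" and "j \<in> rel_component R Y i"
  shows "rel_component R Y j = rel_component R Y i"
proof -
  let ?S = "\<lambda>u v. u \<in> Y \<and> v \<in> Y \<and> R u v"
  have "symp ?S"
    using sym by (auto intro: sympI)
  then have "symp ?S\<^sup>*\<^sup>*"
    by (rule symp_rtranclp)
  then have "?S\<^sup>*\<^sup>* i j" "?S\<^sup>*\<^sup>* j i"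
    using assms(2) by (auto simp: rel_component_def dest: sympD)
  then show ?thesis
    by (auto simp: rel_component_def)
qed

lemma rel_separated_component: "i \<in> Y \<Longrightarrow> rel_separated R Y (rel_component R Y i)"
  using rel_component_subset [of i Y R] by (auto simp: rel_separated_def intro: rel_component_step)

lemma rel_connected_component:
  assumes sym: "\<And>u v. u \<in> Y \<Longrightarrow> v \<in> Y \<Longrightarrow> R u v \<Longrightarrow> R v u" and "i \<in> Y"
  shows "rel_connected R (rel_component R Y i)"
  unfolding rel_connected_def
proof (intro allI impI)
  let ?C = "rel_component R Y i"
  fix A assume "rel_separated R ?C A"
  then have A: "A \<subseteq> ?C" "\<And>u v. u \<in> A \<Longrightarrow> v \<in> ?C \<Longrightarrow> v \<notin> A \<Longrightarrow> \<not> R u v"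
    by (auto simp: rel_separated_def)
  have "j \<in> A \<longleftrightarrow> i \<in> A" if "j \<in> ?C" for j
    using that
  proof (induction rule: rel_component_induct)
    case (step u v)
    then have "v \<in> ?C"
      by (blast intro: rel_component_step)
    then show ?case
      using step A(2) sym by blast
  qed simp
  then show "A = {} \<or> A = ?C"
    using A(1) by blast
qed

lemma rel_component_neq:
  assumes "\<And>u v. u \<in> Y \<Longrightarrow> v \<in> Y \<Longrightarrow> R u v \<Longrightarrow> R v u" "\<not> rel_connected R Y" "i \<in> Y"
  shows "rel_component R Y i \<noteq> Y"
  using rel_connected_component [of Y R i] assms by auto

lemma rel_connected_subset_component:
  assumes "rel_connected R W" "W \<subseteq> Y" "i \<in> W"
  shows "W \<subseteq> rel_component R Y i"
proof (rule ccontr)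
  let ?A = "W \<inter> rel_component R Y i"
  assume "\<not> W \<subseteq> rel_component R Y i"
  then have "?A \<subseteq> W" "?A \<noteq> {}" "?A \<noteq> W"
    using assms(3) rel_component_self [of i R Y] by blast+
  then obtain u v where "u \<in> ?A" "v \<in> W" "v \<notin> ?A" "R u v"
    by (rule rel_connectedE [OF assms(1)])
  then show False
    using assms(2) rel_component_step [of u R Y i v] by blast
qed

lemma rel_connected_insert:
  assumes "rel_connected R Z" "z \<in> Z" "R z v" "R v z" "v \<notin> Z"
  shows "rel_connected R (insert v Z)"
  unfolding rel_connected_def
proof (intro allI impI)
  fix A assume A: "rel_separated R (insert v Z) A"
  then have "rel_separated R Z (A \<inter> Z)"
    by (auto simp: rel_separated_def)
  then consider "A \<inter> Z = {}" | "A \<inter> Z = Z"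
    using assms(1) unfolding rel_connected_def by blast
  then show "A = {} \<or> A = insert v Z"
    using A assms by cases (auto simp: rel_separated_def)
qed

lemma rel_connected_pair: "R i j \<Longrightarrow> R j i \<Longrightarrow> i \<noteq> j \<Longrightarrow> rel_connected R {i, j}"
  using rel_connected_insert [OF rel_connected_singleton [of R j], of j i] by simp

lemma rel_connected_remove_vertex:
  assumes "finite Y" "2 \<le> card Y" "rel_connected R Y"
    and sym: "\<And>u v. u \<in> Y \<Longrightarrow> v \<in> Y \<Longrightarrow> R u v \<Longrightarrow> R v u"
  shows "\<exists>k\<in>Y. rel_connected R (Y - {k})"
proof -
  define \<C> where "\<C> = {Z. Z \<subset> Y \<and> Z \<noteq> {} \<and> rel_connected R Z}"
  have "finite \<C>"
    by (rule finite_subset [of _ "Pow Y"]) (use assms(1) in \<open>auto simp: \<C>_def\<close>)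
  obtain y where "y \<in> Y"
    using assms(2) by fastforce
  then have "{y} \<in> \<C>"
    using assms(2) rel_connected_singleton by (fastforce simp: \<C>_def)
  from finite_has_maximal2 [OF \<open>finite \<C>\<close> this]
  obtain Z where Z: "Z \<in> \<C>" and maximal: "\<forall>Z'\<in>\<C>. Z \<subseteq> Z' \<longrightarrow> Z = Z'"
    by blast
  then have "Z \<subseteq> Y" "Z \<noteq> {}" "Z \<noteq> Y"
    by (auto simp: \<C>_def)
  then obtain u v where uv: "u \<in> Z" "v \<in> Y" "v \<notin> Z" "R u v"
    by (rule rel_connectedE [OF assms(3)])
  then have connected: "rel_connected R (insert v Z)"
    using Z sym by (intro rel_connected_insert [of R Z u v]) (auto simp: \<C>_def)
  have "insert v Z \<notin> \<C>"
    using maximal uv(3) by blast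
  then have "Y - {v} = Z"
    using Z uv connected by (auto simp: \<C>_def)
  then show ?thesis
    using Z uv(2) by (auto simp: \<C>_def)
qed

section \<open>Edge colourings without rainbow triangles\<close>

definition colour_edge :: "('i \<Rightarrow> 'i \<Rightarrow> klein4) \<Rightarrow> klein4 \<Rightarrow> 'i \<Rightarrow> 'i \<Rightarrow> bool" where
  "colour_edge c b i j \<longleftrightarrow> i \<noteq> j \<and> outside b (c i j)"

text \<open>Here \<open>0\<close> counts as a colour of its own, not as the absence of an edge.\<close>

locale gallai =
  fixes c :: "'i \<Rightarrow> 'i \<Rightarrow> klein4" and Y :: "'i set"
  assumes colour_sym: "i \<in> Y \<Longrightarrow> j \<in> Y \<Longrightarrow> i \<noteq> j \<Longrightarrow> c i j = c j i"
    and not_rainbow: "i \<in> Y \<Longrightarrow> j \<in> Y \<Longrightarrow> k \<in> Y \<Longrightarrow> i \<noteq> j \<Longrightarrow> i \<noteq> k \<Longrightarrow> j \<noteq> k \<Longrightarrow>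
      c i j = c i k \<or> c i j = c j k \<or> c i k = c j k"
begin

abbreviation label_component :: "klein4 \<Rightarrow> 'i \<Rightarrow> 'i set" where
  "label_component b \<equiv> rel_component (colour_edge c b) Y"

definition cross_edge :: "klein4 \<Rightarrow> 'i \<Rightarrow> 'i \<Rightarrow> bool" where
  "cross_edge b u v \<longleftrightarrow> c u v = b \<and> label_component b u \<noteq> label_component b v"

lemma colour_edge_sym: "i \<in> Y \<Longrightarrow> j \<in> Y \<Longrightarrow> colour_edge c b i j \<Longrightarrow> colour_edge c b j i"
  using colour_sym by (auto simp: colour_edge_def)

lemma label_component_eq:
  "v \<in> label_component b u \<Longrightarrow> label_component b v = label_component b u"
  using colour_edge_sym by (rule rel_component_eq)

lemma label_component_eq_of_outside:
  assumes "u \<in> Y" "v \<in> Y" "outside b (c u v)"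
  shows "label_component b v = label_component b u"
proof (cases "u = v")
  case False
  then have "v \<in> label_component b u"
    using rel_component_step [OF rel_component_self assms(1,2)] assms(3)
    by (simp add: colour_edge_def)
  then show ?thesis
    by (rule label_component_eq)
qed simp

lemma rel_connected_label_component:
  "p \<in> Y \<Longrightarrow> rel_connected (colour_edge c b) (label_component b p)"
  using colour_edge_sym by (rule rel_connected_component)

lemma cross_edge_irrefl: "cross_edge b u v \<Longrightarrow> u \<noteq> v"
  by (auto simp: cross_edge_def)

lemma cross_edge_sym: "u \<in> Y \<Longrightarrow> v \<in> Y \<Longrightarrow> cross_edge b u v \<Longrightarrow> cross_edge b v u"
  using cross_edge_irrefl colour_sym by (metis cross_edge_def)

lemma cross_edgeI:
  assumes "u \<in> Y" "v \<in> Y" "colour_edge c 0 u v" "label_component b u \<noteq> label_component b v"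
  shows "cross_edge b u v"
  using assms label_component_eq_of_outside [OF assms(1,2), of b]
  by (auto simp: cross_edge_def colour_edge_def outside_def)

lemma cross_edge_component_left:
  assumes "b \<noteq> 0" "u' \<in> label_component b u" "w \<in> Y" "cross_edge b u w"
  shows "cross_edge b u' w"
  using assms(2)
proof (induction rule: rel_component_induct)
  case (step s t)
  have st: "s \<noteq> t" "outside b (c s t)"
    using step.hyps(4) by (simp_all add: colour_edge_def)
  have "label_component b t = label_component b s"
    using label_component_eq_of_outside step.hyps(2,3) st(2) by blast
  then have ne: "label_component b t \<noteq> label_component b w"
    using step.IH by (simp add: cross_edge_def)
  then have "\<not> outside b (c t w)"
    using label_component_eq_of_outside [OF step.hyps(3) assms(3)] by metis
  moreover have "c s w = b" "s \<noteq> w" "t \<noteq> w"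
    using step.IH cross_edge_irrefl ne by (auto simp: cross_edge_def)
  ultimately have "c t w = b"
    using not_rainbow [of s t w] st step.hyps(2,3) assms(1,3) by (auto simp: outside_def)
  then show ?case
    using ne by (simp add: cross_edge_def)
qed fact

lemma cross_edge_components:
  assumes "b \<noteq> 0" "u \<in> Y" "w \<in> Y" "cross_edge b u w"
    and "u' \<in> label_component b u" "w' \<in> label_component b w"
  shows "cross_edge b u' w'"
proof -
  have Y: "u' \<in> Y" "w' \<in> Y"
    using rel_component_subset [OF assms(2)] rel_component_subset [OF assms(3)] assms(5,6) by fast+
  have "cross_edge b w u'"
    using cross_edge_component_left [OF assms(1,5,3,4)] cross_edge_sym Y(1) assms(3) by blast
  then have "cross_edge b w' u'"
    using cross_edge_component_left [OF assms(1,6) Y(1)] by blast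
  then show ?thesis
    using cross_edge_sym Y by blast
qed

lemma ex_cross_edge:
  assumes "rel_connected (colour_edge c 0) Y" "\<not> rel_connected (colour_edge c b) Y" "b \<noteq> 0" "r \<in> Y"
  shows "\<exists>w\<in>Y. cross_edge b r w"
proof -
  let ?C = "label_component b r"
  have "?C \<noteq> Y"
    using assms by (intro rel_component_neq [OF colour_edge_sym])
  moreover have "?C \<subseteq> Y" "?C \<noteq> {}"
    using rel_component_subset [OF assms(4)] rel_component_self by fast+
  ultimately obtain u w where uw: "u \<in> ?C" "w \<in> Y" "w \<notin> ?C" "colour_edge c 0 u w"
    using rel_connectedE [OF assms(1)] by metis
  have "u \<in> Y" "label_component b u = ?C"
    using uw(1) \<open>?C \<subseteq> Y\<close> label_component_eq by auto
  moreover have "label_component b u \<noteq> label_component b w"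
    using \<open>label_component b u = ?C\<close> uw(3) rel_component_self by metis
  ultimately have "cross_edge b u w"
    using uw cross_edgeI by blast
  then show ?thesis
    using cross_edge_component_left [OF assms(3) _ uw(2), where u = u and u' = r]
      \<open>label_component b u = ?C\<close> uw(2)
    by auto
qed

lemma rel_connected_cross_edge:
  assumes "rel_connected (colour_edge c 0) Y" "\<not> rel_connected (colour_edge c b) Y" "b \<noteq> 0"
  shows "rel_connected (cross_edge b) Y"
  unfolding rel_connected_def
proof (intro allI impI, rule ccontr)
  fix A assume A: "rel_separated (cross_edge b) Y A" "\<not> (A = {} \<or> A = Y)"
  then have "A \<subseteq> Y" "A \<noteq> {}" "A \<noteq> Y"
    by (auto simp: rel_separated_def)
  then obtain u v where uv: "u \<in> A" "v \<in> Y" "v \<notin> A" "colour_edge c 0 u v"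
    by (rule rel_connectedE [OF assms(1)])
  then have "u \<in> Y"
    using \<open>A \<subseteq> Y\<close> by blast
  have "\<exists>u\<in>A. \<exists>v\<in>Y - A. cross_edge b u v"
  proof (cases "label_component b u = label_component b v")
    case False
    then show ?thesis
      using cross_edgeI uv \<open>u \<in> Y\<close> by blast
  next
    case True
    obtain w where w: "w \<in> Y" "cross_edge b u w"
      using ex_cross_edge [OF assms \<open>u \<in> Y\<close>] by blast
    have "cross_edge b v w"
      using cross_edge_component_left [OF assms(3) _ w] True by simp
    then show ?thesis
      using w uv cross_edge_sym by blast
  qed
  then show False
    using A(1) by (auto simp: rel_separated_def)
qed

end

lemma gallai_subset: "gallai c Y \<Longrightarrow> Z \<subseteq> Y \<Longrightarrow> gallai c Z"
  unfolding gallai_def by (simp add: subset_iff)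

locale gallai_new_vertex = gallai c "insert k Z" for c k and Z :: "'i set" +
  fixes a :: klein4
  assumes new: "k \<notin> Z" and label_nonzero: "a \<noteq> 0"
    and connected_old: "rel_connected (colour_edge c 0) Z"
    and disconnected_old: "\<not> rel_connected (colour_edge c a) Z"
    and connected_new: "rel_connected (colour_edge c a) (insert k Z)"
begin

sublocale old: gallai c Z
  by (rule gallai_subset [OF gallai_axioms]) blast

lemma component_subset: "p \<in> Z \<Longrightarrow> old.label_component a p \<subseteq> Z"
  by (rule rel_component_subset)

lemma component_attached:
  assumes "p \<in> Z"
  shows "\<exists>q\<in>old.label_component a p. outside a (c k q)"
proof -
  let ?C = "old.label_component a p"
  have "?C \<subseteq> insert k Z" "?C \<noteq> {}" "?C \<noteq> insert k Z"
    using component_subset [OF assms] new rel_component_self [of p "colour_edge c a" Z] by blast+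
  then obtain u v where uv: "u \<in> ?C" "v \<in> insert k Z" "v \<notin> ?C" "colour_edge c a u v"
    by (rule rel_connectedE [OF connected_new])
  then have "u \<in> Z" "v = k"
    using component_subset [OF assms] rel_component_step [OF uv(1), of v] by blast+
  then have "outside a (c k u)"
    using uv(4) colour_sym [of u k] by (simp add: colour_edge_def)
  then show ?thesis
    using uv(1) by blast
qed

lemma attached_colour_cases:
  assumes "p \<in> Z" "q \<in> Z" "old.cross_edge a p q" "outside a (c k q)"
  shows "c k p = a \<or> c k p = c k q"
  using not_rainbow [of k p q] assms new old.cross_edge_irrefl [OF assms(3)]
  by (auto simp: old.cross_edge_def outside_def)

lemma ex_attached_cross_edge:
  assumes "p \<in> Z"
  shows "\<exists>w\<in>Z. outside a (c k w) \<and> (\<forall>q\<in>old.label_component a p. old.cross_edge a q w)"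
proof -
  obtain w where w: "w \<in> Z" "old.cross_edge a p w"
    using old.ex_cross_edge [OF connected_old disconnected_old label_nonzero assms] by blast
  obtain w' where "w' \<in> old.label_component a w" "outside a (c k w')"
    using component_attached [OF w(1)] by blast
  then show ?thesis
    using old.cross_edge_components [OF label_nonzero assms w] component_subset [OF w(1)] by blast
qed

lemma attached_colours_agree:
  assumes "u \<in> Z" "v \<in> Z" "old.cross_edge a u v"
    and "u' \<in> old.label_component a u" "outside a (c k u')"
    and "v' \<in> old.label_component a v" "outside a (c k v')"
  shows "c k u' = c k v'"
proof -
  have "old.cross_edge a u' v'"
    using old.cross_edge_components [OF label_nonzero] assms(1-4,6) by blast
  moreover have "u' \<in> Z" "v' \<in> Z"
    using assms(1,2,4,6) component_subset by blast+
  ultimately show ?thesis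
    using attached_colour_cases [of u' v'] assms(5,7) by (auto simp: outside_def)
qed

lemma attached_colour_unique:
  assumes "p \<in> Z" "outside a (c k p)" "q \<in> Z" "outside a (c k q)"
  shows "c k q = c k p"
proof -
  define A where "A = {u \<in> Z. \<forall>u'\<in>old.label_component a u. outside a (c k u') \<longrightarrow> c k u' = c k p}"
  have "p \<in> A"
  proof -
    obtain w where "w \<in> Z" "outside a (c k w)" "old.cross_edge a p w"
      using ex_attached_cross_edge [OF assms(1)] rel_component_self by fast
    then have same: "c k u' = c k w" if "u' \<in> old.label_component a p" "outside a (c k u')" for u'
      using attached_colours_agree [of p w u' w] that assms(1) by simp
    show ?thesis
      using same same [OF rel_component_self assms(2)] assms(1) by (simp add: A_def)
  qed
  moreover have "v \<in> A" if "u \<in> A" "v \<in> Z" "old.cross_edge a u v" for u v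
  proof -
    have u: "u \<in> Z" "\<And>u'. u' \<in> old.label_component a u \<Longrightarrow> outside a (c k u') \<Longrightarrow> c k u' = c k p"
      using that(1) by (simp_all add: A_def)
    obtain u' where u': "u' \<in> old.label_component a u" "outside a (c k u')"
      using component_attached [OF u(1)] by blast
    then have "c k v' = c k p" if "v' \<in> old.label_component a v" "outside a (c k v')" for v'
      using attached_colours_agree [OF u(1) \<open>v \<in> Z\<close> \<open>old.cross_edge a u v\<close> u' that] u(2) u' by simp
    then show ?thesis
      using \<open>v \<in> Z\<close> by (simp add: A_def)
  qed
  moreover have "A \<subseteq> Z"
    by (auto simp: A_def)
  ultimately have "A = Z"
    using old.rel_connected_cross_edge [OF connected_old disconnected_old label_nonzero]
    by (metis empty_iff rel_connectedE)
  then have "q \<in> A"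
    using assms(3) by blast
  then show ?thesis
    using assms(4) by (simp add: A_def)
qed

end

text \<open>The edges of colour \<open>a\<close> form the path \<open>p q r s\<close> and those of colour \<open>e\<close> the path \<open>q s p r\<close>.\<close>

definition complementary_paths ::
    "('i \<Rightarrow> 'i \<Rightarrow> klein4) \<Rightarrow> klein4 \<Rightarrow> klein4 \<Rightarrow> 'i \<Rightarrow> 'i \<Rightarrow> 'i \<Rightarrow> 'i \<Rightarrow> bool" where
  "complementary_paths c a e p q r s \<longleftrightarrow> c p q = a \<and> c q r = a \<and> c r s = a \<and>
    c q s = e \<and> c p s = e \<and> c p r = e"

context gallai_new_vertex
begin

lemma ex_complementary_paths:
  assumes "p \<in> Z" "c k p = a"
  shows "\<exists>e u v w. u \<in> Z \<and> v \<in> Z \<and> w \<in> Z \<and> distinct [u, v, w] \<and> outside a e \<and>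
    complementary_paths c a e k u v w"
proof -
  let ?C = "old.label_component a p"
  define A where "A = {u \<in> ?C. c k u = a}"
  obtain q where q: "q \<in> ?C" "outside a (c k q)"
    using component_attached [OF assms(1)] by blast
  then have "p \<in> A" "q \<notin> A"
    using assms(2) by (auto simp: A_def)
  then have "A \<noteq> {}" "A \<noteq> ?C"
    using q(1) by blast+
  moreover have "A \<subseteq> ?C"
    by (auto simp: A_def)
  ultimately obtain u w where "u \<in> A" "w \<in> ?C" "w \<notin> A" "colour_edge c a u w"
    using old.rel_connected_label_component [OF assms(1)] by (metis rel_connectedE)
  then have uw: "u \<in> ?C" "c k u = a" "w \<in> ?C" "c k w \<noteq> a" "u \<noteq> w" "outside a (c u w)"
    by (auto simp: A_def colour_edge_def)
  then have Z: "u \<in> Z" "w \<in> Z"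
    using component_subset [OF assms(1)] by blast+
  obtain v where v: "v \<in> Z" "outside a (c k v)" "\<forall>q\<in>?C. old.cross_edge a q v"
    using ex_attached_cross_edge [OF assms(1)] by blast
  have ne: "u \<noteq> v" "w \<noteq> v" "k \<noteq> u" "k \<noteq> w"
    using v(3) uw(1,3) Z new old.cross_edge_irrefl by blast+
  have kw: "c k w = c k v"
    using attached_colour_cases [OF Z(2) v(1) _ v(2)] v(3) uw(3,4) by blast
  moreover have "c u w = c k v"
    using not_rainbow [of k u w] Z ne uw kw v(2) by (auto simp: outside_def)
  moreover have "c u v = a" "c v w = a"
    using v(3) uw(1,3) old.colour_sym [OF v(1) Z(2)] ne by (auto simp: old.cross_edge_def)
  ultimately have "complementary_paths c a (c k v) k u v w"
    using uw(2) by (simp add: complementary_paths_def)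
  then show ?thesis
    using Z v(1,2) ne uw(5) by auto
qed

lemma ex_disconnected_label_new:
  assumes "\<And>e u v w. u \<in> Z \<Longrightarrow> v \<in> Z \<Longrightarrow> w \<in> Z \<Longrightarrow> distinct [u, v, w] \<Longrightarrow> outside a e \<Longrightarrow>
    \<not> complementary_paths c a e k u v w"
  shows "\<exists>b. b \<noteq> 0 \<and> \<not> rel_connected (colour_edge c b) (insert k Z)"
proof -
  have not_a: "c k p \<noteq> a" if "p \<in> Z" for p
    using ex_complementary_paths [OF that] assms by blast
  obtain p where "p \<in> Z"
    using disconnected_old by (auto simp: rel_connected_def rel_separated_def)
  then obtain w where w: "w \<in> Z" "outside a (c k w)"
    using ex_attached_cross_edge by blast
  have "\<not> outside (c k w) (c k q)" if q: "q \<in> Z" for q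
  proof -
    obtain v where "v \<in> Z" "outside a (c k v)" "old.cross_edge a q v"
      using ex_attached_cross_edge [OF q] rel_component_self by fast
    then have "c k q = c k w"
      using attached_colour_cases [OF q] not_a [OF q] attached_colour_unique [OF w] by metis
    then show ?thesis by simp
  qed
  then have "\<not> rel_connected (colour_edge c (c k w)) (insert k Z)"
    using w(1) new unfolding rel_connected_def
    by (auto simp: colour_edge_def rel_separated_def intro!: exI [of _ "{k}"])
  then show ?thesis
    using w(2) by (auto simp: outside_def)
qed

end

lemma not_rel_connected_colour_edge_pair:
  "i \<noteq> j \<Longrightarrow> \<not> outside b (c i j) \<Longrightarrow> \<not> rel_connected (colour_edge c b) {i, j}"
  unfolding rel_connected_def
  by (auto simp: colour_edge_def rel_separated_def intro!: exI [of _ "{i}"])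

lemma ex_disconnected_label_pair:
  assumes "i \<noteq> j"
  shows "\<exists>b. b \<noteq> 0 \<and> \<not> rel_connected (colour_edge c b) {i, j}"
proof (cases "c i j = 0")
  case True
  then show ?thesis
    using not_rel_connected_colour_edge_pair [of i j K1 c] assms
    by (intro exI [of _ K1]) (simp add: outside_def zero_klein4_def)
next
  case False
  then show ?thesis
    using not_rel_connected_colour_edge_pair [OF assms, of "c i j" c] by auto
qed

lemma ex_disconnected_label_of_disconnected_0:
  assumes "\<not> rel_connected (colour_edge c 0) Y"
  shows "\<exists>b. b \<noteq> 0 \<and> \<not> rel_connected (colour_edge c b) Y"
proof (intro exI conjI)
  show "\<not> rel_connected (colour_edge c K1) Y"
    using assms rel_connected_mono [of "colour_edge c K1" Y "colour_edge c 0"]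
    by (auto simp: colour_edge_def outside_def)
qed (simp add: zero_klein4_def)

theorem gallai_ex_disconnected_label:
  assumes "gallai c Y" "finite Y" "2 \<le> card Y"
    and "\<And>a e p q r s. {p, q, r, s} \<subseteq> Y \<Longrightarrow> distinct [p, q, r, s] \<Longrightarrow> a \<noteq> 0 \<Longrightarrow> outside a e \<Longrightarrow>
      \<not> complementary_paths c a e p q r s"
  shows "\<exists>b. b \<noteq> 0 \<and> \<not> rel_connected (colour_edge c b) Y"
  using assms
proof (induction "card Y" arbitrary: Y rule: less_induct)
  case (less Y)
  interpret gallai c Y by fact
  consider (pair) "card Y = 2" | (disconnected_0) "\<not> rel_connected (colour_edge c 0) Y"
    | (step) "card Y \<noteq> 2" "rel_connected (colour_edge c 0) Y"
    by metis
  then show ?case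
  proof cases
    case pair
    then obtain i j where "Y = {i, j}" "i \<noteq> j"
      by (meson card_2_iff)
    then show ?thesis
      by (simp add: ex_disconnected_label_pair)
  next
    case disconnected_0
    then show ?thesis
      by (rule ex_disconnected_label_of_disconnected_0)
  next
    case step
    obtain k where k: "k \<in> Y" "rel_connected (colour_edge c 0) (Y - {k})"
      using rel_connected_remove_vertex [OF less.prems(2,3) step(2)] colour_edge_sym by blast
    have card: "card (Y - {k}) < card Y" "2 \<le> card (Y - {k})"
      using step(1) k(1) less.prems(2,3) by auto
    have "gallai c (Y - {k})"
      by (rule gallai_subset [OF less.prems(1)]) blast
    then obtain a where a: "a \<noteq> 0" "\<not> rel_connected (colour_edge c a) (Y - {k})"
      using less.hyps [OF card(1) _ _ card(2)] less.prems(2,4) by fastforce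
    show ?thesis
    proof (cases "rel_connected (colour_edge c a) Y")
      case True
      interpret extension: gallai_new_vertex c k "Y - {k}" a
        using less.prems(1) k a True
        by (simp add: gallai_new_vertex_def gallai_new_vertex_axioms_def insert_absorb)
      have "\<exists>b. b \<noteq> 0 \<and> \<not> rel_connected (colour_edge c b) (insert k (Y - {k}))"
        by (rule extension.ex_disconnected_label_new) (use less.prems(4) k(1) a(1) in auto)
      then show ?thesis
        using k(1) by (simp add: insert_absorb)
    qed (use a in blast)
  qed
qed

section \<open>Edges on faces\<close>

context latin4
begin

abbreviation edge :: "klein4 \<Rightarrow> ('i \<Rightarrow> klein4) \<Rightarrow> 'i \<Rightarrow> 'i \<Rightarrow> bool" where
  "edge b x \<equiv> colour_edge (\<lambda>i j. colour i j x) b"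

definition face_edge :: "klein4 \<Rightarrow> 'i set \<Rightarrow> ('i \<Rightarrow> klein4) \<Rightarrow> 'i \<Rightarrow> 'i \<Rightarrow> bool" where
  "face_edge b E z i j \<longleftrightarrow> (\<exists>x\<in>face E z. edge b x i j)"

definition mixed_difference :: "'i \<Rightarrow> 'i \<Rightarrow> ('i \<Rightarrow> klein4) \<Rightarrow> klein4 \<Rightarrow> klein4 \<Rightarrow> klein4" where
  "mixed_difference i j x u v = f x + f (x(i := u)) + f (x(j := v)) + f (x(i := u, j := v))"

lemma gallai_colour: "Y \<subseteq> I \<Longrightarrow> gallai (\<lambda>i j. colour i j x) Y"
  by unfold_locales (use colour_sym colour_not_rainbow in blast)+

lemma edge_sym: "i \<in> I \<Longrightarrow> j \<in> I \<Longrightarrow> edge b x i j \<Longrightarrow> edge b x j i"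
  using colour_sym by (auto simp: colour_edge_def)

lemma face_edge_sym: "i \<in> I \<Longrightarrow> j \<in> I \<Longrightarrow> face_edge b E z i j \<Longrightarrow> face_edge b E z j i"
  unfolding face_edge_def by (blast intro: edge_sym)

lemma edge_upd_endpoint:
  assumes "i \<in> I" "j \<in> I"
  shows "edge b (x(i := v)) i j \<longleftrightarrow> edge b x i j" "edge b (x(j := v)) i j \<longleftrightarrow> edge b x i j"
  using assms by (auto simp: colour_edge_def)

lemma face_move [intro]: "x \<in> face E z \<Longrightarrow> i \<in> E \<Longrightarrow> move i a x \<in> face E z"
  by (simp add: move_def face_upd)

lemma mixed_difference_move_val:
  assumes "i \<in> I" "j \<in> I" "i \<noteq> j"
  shows "mixed_difference i j x (move_val i a x) (move_val j b x) =
    (let d = colour i j x in if d \<noteq> 0 \<and> outside d a \<and> outside d b then d else 0)"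
  using assms by (simp add: mixed_difference_def f_plane_point square_def Let_def ac_simps)

lemma edge_iff_mixed_difference:
  assumes "i \<in> I" "j \<in> I" "i \<noteq> j"
  shows "edge b x i j \<longleftrightarrow> (\<exists>u v. outside b (mixed_difference i j x u v))"
proof
  let ?d = "colour i j x"
  assume "edge b x i j"
  then have "outside b ?d"
    by (simp add: colour_edge_def)
  moreover obtain a where "outside ?d a"
    using ex_outside by blast
  ultimately have "outside b (mixed_difference i j x (move_val i a x) (move_val j a x))"
    using assms by (auto simp: mixed_difference_move_val outside_def)
  then show "\<exists>u v. outside b (mixed_difference i j x u v)" by blast
next
  assume "\<exists>u v. outside b (mixed_difference i j x u v)"
  then obtain u v where uv: "outside b (mixed_difference i j x u v)" by blast
  obtain a a' where "u = move_val i a x" "v = move_val j a' x"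
    using ex_move_val assms(1,2) by meson
  then show "edge b x i j"
    using uv assms
    by (auto simp: mixed_difference_move_val Let_def colour_edge_def split: if_splits)
qed

lemma not_edge_additive:
  assumes "i \<in> I" "j \<in> I" "i \<noteq> j" "b \<noteq> 0" "\<not> edge b x i j"
  shows "outside b (f (x(i := u, j := v)) + f (x(j := v))) = outside b (f (x(i := u)) + f x)"
  using assms edge_iff_mixed_difference [OF assms(1-3), of x b]
  by (auto simp: outside_add mixed_difference_def)

lemma edge_upd_iff:
  assumes "i \<in> E" "j \<in> E" "l \<in> E" "E \<subseteq> I" "i \<noteq> l" "b \<noteq> 0" "x \<in> face E z" "\<not> face_edge b E z i l"
  shows "edge b (x(l := v)) i j \<longleftrightarrow> edge b x i j"
proof -
  have I: "i \<in> I" "j \<in> I" "l \<in> I"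
    using assms by auto
  consider (loop) "j = i" | (endpoint) "j = l" | (other) "j \<noteq> i" "j \<noteq> l" by blast
  then show ?thesis
  proof cases
    case loop
    then show ?thesis
      by (simp add: colour_edge_def)
  next
    case endpoint
    then show ?thesis
      using I by (simp add: edge_upd_endpoint)
  next
    case other
    have "\<not> edge b x i l" "\<not> edge b (x(j := w)) i l" for w
      using assms(2,7,8) by (auto simp: face_edge_def)
    then have "outside b (mixed_difference i j (x(l := v)) u w)
        = outside b (mixed_difference i j x u w)" for u w
      using not_edge_additive [OF I(1,3) assms(5,6), of x u v]
        not_edge_additive [OF I(1,3) assms(5,6), of "x(j := w)" u v] other assms(5,6)
      by (simp add: mixed_difference_def outside_add fun_upd_twist) argo
    then show ?thesis
      using I other(1) by (simp add: edge_iff_mixed_difference)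
  qed
qed

lemma face_edge_restrict:
  assumes E: "E \<subseteq> I" "finite E" and "b \<noteq> 0" and sep: "rel_separated (face_edge b E z) E W"
    and ij: "i \<in> W" "j \<in> W" "face_edge b E z i j" and z': "z' \<in> face E z"
  shows "face_edge b W z' i j"
proof -
  have W: "W \<subseteq> E" "\<And>l. l \<in> E - W \<Longrightarrow> \<not> face_edge b E z i l"
    using sep ij(1) by (auto simp: rel_separated_def)
  obtain x where x: "x \<in> face E z" "edge b x i j"
    using ij by (auto simp: face_edge_def)
  define y where "y = override_on z' x W"
  have "finite (E - W)" "x \<in> face (E - W) x" "y \<in> face (E - W) x"
    using E x z' by (auto simp: y_def face_def override_on_def)
  then have "edge b y i j"
  proof (induction rule: face_induct)
    case (upd w k v)
    then have "w \<in> face E z"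
      using x(1) by (auto simp: face_def)
    then show ?case
      using edge_upd_iff [of i E j k b w z v] upd E(1) ij W \<open>b \<noteq> 0\<close> by blast
  qed (rule x)
  moreover have "y \<in> face W z'"
    by (simp add: y_def face_override_on)
  ultimately show ?thesis
    by (auto simp: face_edge_def)
qed

section \<open>Level sets\<close>

definition reachable :: "klein4 \<Rightarrow> 'i set \<Rightarrow> ('i \<Rightarrow> klein4) \<Rightarrow> ('i \<Rightarrow> klein4) \<Rightarrow> bool" where
  "reachable b E = (\<lambda>x y. \<exists>i\<in>E. y = move i b x)\<^sup>*\<^sup>*"

lemma reachable_refl [simp]: "reachable b E x x"
  by (simp add: reachable_def)

lemma reachable_trans [trans]: "reachable b E x y \<Longrightarrow> reachable b E y w \<Longrightarrow> reachable b E x w"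
  by (simp add: reachable_def)

lemma reachable_move: "i \<in> E \<Longrightarrow> reachable b E x (move i b x)"
  unfolding reachable_def by blast

lemma reachable_induct [consumes 1, case_names base step]:
  assumes "reachable b E x y" "P x"
    and "\<And>w i. reachable b E x w \<Longrightarrow> P w \<Longrightarrow> i \<in> E \<Longrightarrow> P (move i b w)"
  shows "P y"
  using assms(1) unfolding reachable_def
  by induction (use assms(2,3) in \<open>auto simp: reachable_def\<close>)

lemma reachable_face: "reachable b E x y \<Longrightarrow> x \<in> face E z \<Longrightarrow> y \<in> face E z"
  by (induction rule: reachable_induct) auto

text \<open>A flip at \<open>i\<close> is a move \<open>move i c\<close> with \<open>c\<close> outside \<open>{0, b}\<close>. Up to moves of type \<open>b\<close> it does not
  depend on \<open>c\<close>, flips commute, and flips at adjacent coordinates agree. Hence the classes of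
  mutually reachable points form an orbit of an elementary abelian group, which has order 2 when
  the graph of label \<open>b\<close> is connected.\<close>

context
  fixes b :: klein4 and E :: "'i set"
  assumes label: "b \<noteq> 0" and coordinates: "E \<subseteq> I"
begin

lemma reachable_sym: "reachable b E x y \<Longrightarrow> reachable b E y x"
proof (induction rule: reachable_induct)
  case (step w i)
  then have "reachable b E (move i b w) (move i b (move i b w))"
    by (intro reachable_move)
  then have "reachable b E (move i b w) w"
    using step coordinates by (simp add: subset_iff)
  then show ?case
    using step reachable_trans by blast
qed simp

lemma reachable_flips:
  assumes "i \<in> E" "outside b c" "outside b c'"
  shows "reachable b E (move i c x) (move i c' x)"
proof -
  have "\<not> outside b (c + c')"
    using assms(2,3) label by (simp add: outside_add)
  then have "c' = c \<or> c' = c + b"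
    by (rule not_outside_add_cases)
  moreover have "move i (c + b) x = move i b (move i c x)"
    using assms(1) coordinates by (simp add: subset_iff)
  ultimately show ?thesis
    using reachable_move [OF assms(1), of b "move i c x"] by auto
qed

lemma reachable_flip_move:
  assumes "i \<in> E" "k \<in> E" "outside b c"
  shows "reachable b E (move i c x) (move i c (move k b x))"
proof (cases "k = i")
  case True
  then have "move i c (move k b x) = move i b (move i c x)"
    using assms coordinates by (simp add: subset_iff add.commute)
  then show ?thesis
    using reachable_move assms(1) by simp
next
  case False
  define d where "d = colour k i x"
  obtain c' where c': "outside b c'" "twist d b c' = c'" "twist d c' b = b"
  proof (cases "outside b d")
    case True
    then show ?thesis
      using that [of d] by (simp add: twist_def square_def ac_simps)
  next
    case False
    then show ?thesis
      using that [of c] assms(3) by (auto simp: twist_def square_def outside_def ac_simps)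
  qed
  have "move i c' (move k b x) = move k b (move i c' x)"
    using move_commute [of k i d x c' b] c' assms coordinates False by (auto simp: d_def)
  then have "reachable b E (move i c' x) (move i c' (move k b x))"
    using reachable_move assms(2) by simp
  then show ?thesis
    using reachable_flips [OF assms(1)] c'(1) assms(3) reachable_trans by meson
qed

lemma reachable_flip_cong:
  assumes "i \<in> E" "outside b c" "reachable b E x y"
  shows "reachable b E (move i c x) (move i c y)"
  using assms(3)
  by (induction rule: reachable_induct) (auto intro: reachable_trans reachable_flip_move assms(1,2))

lemma reachable_flip_commute:
  assumes "i \<in> E" "j \<in> E" "outside b c"
  shows "reachable b E (move j c (move i c x)) (move i c (move j c x))"
proof (cases "i = j")
  case False
  define d where "d = colour i j x"
  obtain e e' where e: "outside b e" "outside b e'" "outside b (twist d e e')"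
      "outside b (twist d (twist d e e') e)"
  proof (cases "outside b d")
    case True
    then show ?thesis
      using that [of d d] by (simp add: twist_def square_def ac_simps)
  next
    case False
    then have "outside b (twist d c c)" "outside b (twist d (twist d c c) c)"
      using assms(3) label by (auto simp: twist_def square_def outside_add)
    then show ?thesis
      using that [of c c] assms by simp
  qed
  have eq: "move j e' (move i e x) = move i (twist d (twist d e e') e) (move j (twist d e e') x)"
    using move_commute [of i j d x e' e] assms coordinates False by (auto simp: d_def)
  have "reachable b E (move j c (move i c x)) (move j c (move i e x))"
    by (intro reachable_flip_cong reachable_flips assms e)
  also have "reachable b E (move j c (move i e x)) (move j e' (move i e x))"
    by (intro reachable_flips assms e)
  also note eq
  also have "reachable b E (move i (twist d (twist d e e') e) (move j (twist d e e') x))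
      (move i c (move j (twist d e e') x))"
    by (intro reachable_flips assms e)
  also have "reachable b E (move i c (move j (twist d e e') x)) (move i c (move j c x))"
    by (intro reachable_flip_cong reachable_flips assms e)
  finally show ?thesis .
qed simp

lemma reachable_flip_edge:
  assumes "i \<in> E" "j \<in> E" "outside b c" "edge b x i j"
  shows "reachable b E (move i c x) (move j c x)"
proof -
  define d where "d = colour i j x"
  have d: "outside b d" "i \<noteq> j"
    using assms(4) by (auto simp: colour_edge_def d_def)
  have e: "outside b (b + d)" "twist d b (b + d) = b" "twist d b b = b + d"
  proof -
    have "\<forall>b d. b \<noteq> 0 \<longrightarrow> outside b d \<longrightarrow>
        outside b (b + d) \<and> twist d b (b + d) = b \<and> twist d b b = b + d"
      by code_simp
    then show "outside b (b + d)" "twist d b (b + d) = b" "twist d b b = b + d"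
      using label d(1) by blast+
  qed
  have "reachable b E (move i c x) (move i (b + d) x)"
    by (intro reachable_flips assms e)
  also have "reachable b E (move i (b + d) x) (move i (b + d) (move j b x))"
    by (intro reachable_flip_move assms e)
  also have "move i (b + d) (move j b x) = move j (b + d) (move i b x)"
    using move_commute [of i j d x "b + d" b] assms coordinates d e by (simp add: d_def subset_iff)
  also have "reachable b E (move j (b + d) (move i b x)) (move j (b + d) x)"
    by (rule reachable_sym, intro reachable_flip_move assms e)
  also have "reachable b E (move j (b + d) x) (move j c x)"
    by (intro reachable_flips assms e)
  finally show ?thesis .
qed

lemma reachable_upd:
  assumes "k \<in> E" "\<not> outside b (f w + f (w(k := v)))"
  shows "reachable b E w (w(k := v))"
proof -
  have "k \<in> I"
    using assms(1) coordinates by blast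
  moreover have "f w + f (w(k := v)) = 0 \<or> f w + f (w(k := v)) = b"
    using assms(2) by (auto simp: outside_def)
  ultimately show ?thesis
    using upd_eq_move [of k w v] reachable_move [OF assms(1), of b w] by auto
qed

lemma reachable_flip_upd:
  assumes "k \<in> E" "outside b c" "outside b (f w + f (w(k := v)))"
  shows "reachable b E (move k c w) (w(k := v))"
  using reachable_flips [OF assms, of w] upd_eq_move [of k w v] assms(1) coordinates
  by (simp add: subset_iff)

lemma flips_agree_propagate:
  assumes "finite E" "i \<in> E" "j \<in> E" "outside b c" "edge b x i j" "x \<in> face E z" "y \<in> face E z"
  shows "reachable b E (move i c y) (move j c y)"
  using assms(1,6,7)
proof (induction rule: face_induct)
  case base
  then show ?case
    using reachable_flip_edge assms(2-5) by blast
next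
  case (upd w k v)
  note cong = reachable_flip_cong [OF _ assms(4)] and comm = reachable_flip_commute [OF _ _ assms(4)]
  let ?w = "w(k := v)"
  show ?case
  proof (cases "outside b (f w + f ?w)")
    case False
    then have "reachable b E w ?w"
      by (rule reachable_upd [OF upd(2)])
    then have "reachable b E (move i c ?w) (move i c w)" "reachable b E (move j c w) (move j c ?w)"
      using cong assms(2,3) reachable_sym by blast+
    then show ?thesis
      using upd.IH reachable_trans by blast
  next
    case True
    then have flip: "reachable b E (move k c w) ?w"
      by (rule reachable_flip_upd [OF upd(2) assms(4)])
    then have "reachable b E (move i c ?w) (move i c (move k c w))"
      using cong assms(2) reachable_sym by blast
    also have "reachable b E \<dots> (move k c (move i c w))"
      using comm upd(2) assms(2) by blast
    also have "reachable b E \<dots> (move k c (move j c w))"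
      using cong upd by blast
    also have "reachable b E \<dots> (move j c (move k c w))"
      using comm upd(2) assms(3) by blast
    also have "reachable b E \<dots> (move j c ?w)"
      using cong assms(3) flip by blast
    finally show ?thesis .
  qed
qed

lemma flips_agree:
  assumes "finite E" "rel_connected (face_edge b E z) E" "i \<in> E" "j \<in> E" "outside b c" "x \<in> face E z"
  shows "reachable b E (move i c x) (move j c x)"
proof -
  define A where "A = {j \<in> E. \<forall>w\<in>face E z. reachable b E (move i c w) (move j c w)}"
  have "q \<in> A" if pq: "p \<in> A" "q \<in> E" "face_edge b E z p q" for p q
  proof -
    have p: "p \<in> E" "\<And>w. w \<in> face E z \<Longrightarrow> reachable b E (move i c w) (move p c w)"
      using pq(1) by (auto simp: A_def)
    obtain y where "y \<in> face E z" "edge b y p q"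
      using pq(3) by (auto simp: face_edge_def)
    then have "reachable b E (move p c w) (move q c w)" if "w \<in> face E z" for w
      using flips_agree_propagate [OF assms(1) p(1) \<open>q \<in> E\<close> assms(5)] that by blast
    then have "reachable b E (move i c w) (move q c w)" if "w \<in> face E z" for w
      using p(2) that reachable_trans by blast
    then show ?thesis
      using pq(2) by (simp add: A_def)
  qed
  then have "rel_separated (face_edge b E z) E A"
    by (auto simp: rel_separated_def A_def)
  then have "A = {} \<or> A = E"
    using assms(2) by (simp add: rel_connected_def)
  moreover have "i \<in> A"
    using assms(3) by (simp add: A_def)
  ultimately have "j \<in> A"
    using assms(4) by blast
  then show ?thesis
    using assms(6) by (simp add: A_def)
qed

lemma reachable_or_flip_reachable:
  assumes "finite E" "rel_connected (face_edge b E z) E" "i \<in> E" "outside b c"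
    and "x \<in> face E z" "y \<in> face E z"
  shows "reachable b E (if outside b (f x + f y) then move i c x else x) y"
  using assms(1,5,6)
proof (induction rule: face_induct)
  case (upd w k v)
  let ?w = "w(k := v)"
  note agree = flips_agree [OF assms(1,2,3) \<open>k \<in> E\<close> assms(4)]
  have parity: "outside b (f x + f ?w) = (outside b (f x + f w) \<noteq> outside b (f w + f ?w))"
    using label by (simp add: outside_add) argo
  show ?case
  proof (cases "outside b (f w + f ?w)")
    case False
    then have "reachable b E w ?w"
      by (rule reachable_upd [OF upd(2)])
    from reachable_trans [OF upd.IH this] False show ?thesis
      unfolding parity by (simp only: simp_thms)
  next
    case True
    have "reachable b E (if outside b (f x + f ?w) then move i c x else x) (move k c w)"
    proof (cases "outside b (f x + f w)")
      case False
      then have "reachable b E (move k c x) (move k c w)"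
        using upd.IH by (simp add: reachable_flip_cong upd(2) assms(4))
      then show ?thesis
        unfolding parity using reachable_trans [OF agree [OF assms(5)]] True False by simp
    next
      case outside: True
      have "reachable b E (move i c (move i c x)) (move k c (move i c x))"
        using agree assms(3,5) by blast
      also have "reachable b E \<dots> (move k c w)"
        using upd.IH outside by (simp add: reachable_flip_cong upd(2) assms(4))
      finally have "reachable b E x (move k c w)"
        using assms(3) coordinates by (simp add: subset_iff)
      then show ?thesis
        unfolding parity using True outside by simp
    qed
    then show ?thesis
      using reachable_flip_upd [OF upd(2) assms(4) True] reachable_trans by blast
  qed
qed simp

theorem reachable_level_set:
  assumes "finite E" "rel_connected (face_edge b E z) E"
    and "x \<in> face E z" "y \<in> face E z" "\<not> outside b (f x + f y)"
  shows "reachable b E x y"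
proof (cases "E = {}")
  case True
  then have "x = y"
    using assms(3,4) by (auto simp: face_def)
  then show ?thesis by simp
next
  case False
  then obtain i where "i \<in> E" by blast
  obtain c where "outside b c"
    using ex_outside by blast
  then show ?thesis
    using reachable_or_flip_reachable [OF assms(1,2) \<open>i \<in> E\<close> _ assms(3,4)] assms(5) by simp
qed

end

section \<open>Splitting off a component\<close>

lemma increment_reachable:
  assumes "E \<subseteq> I" "rel_separated (face_edge b E z) E W" "j \<in> E - W" "s \<in> face E z" "reachable b W s t"
  shows "f (t(j := v)) + f t = f (s(j := v)) + f s"
  using assms(5)
proof (induction rule: reachable_induct)
  case (step t i)
  have i: "i \<in> I" "j \<in> I" "i \<noteq> j"
    using step assms(1-3) by (auto simp: rel_separated_def)
  have "t \<in> face W s"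
    using reachable_face [OF step.hyps(1) face_self] .
  then have "t \<in> face E z"
    using assms(2,4) by (auto simp: face_def rel_separated_def)
  then have "\<not> edge b t i j"
    using assms(2,3) step.hyps(2) by (auto simp: face_edge_def rel_separated_def)
  then have colour: "\<not> outside b (colour i j t)"
    using i by (simp add: colour_edge_def)
  obtain a where a: "v = move_val j a t"
    using ex_move_val [OF i(2)] by blast
  have "f ((move i b t)(j := v)) = f t + square (colour i j t) b a"
    using f_plane_point [OF i, of t b a] a by (simp add: move_def)
  also have "square (colour i j t) b a = b + a"
    using colour by (auto simp: square_def outside_def)
  also have "f t + (b + a) = f (t(j := v)) + b"
    using a i by (simp add: ac_simps)
  finally have "f ((move i b t)(j := v)) = f (t(j := v)) + b" .
  then have "f ((move i b t)(j := v)) + f (move i b t) = f (t(j := v)) + f t"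
    using i by (simp add: ac_simps)
  from this step.IH show ?case
    by (rule trans)
qed simp

lemma level_set_upd:
  assumes E: "E \<subseteq> I" "finite E" and "b \<noteq> 0" and sep: "rel_separated (face_edge b E z) E W"
    and conn: "rel_connected (face_edge b E z) W"
    and uv: "u \<in> face E z" "v \<in> face W u" "f u = f v" and j: "j \<in> E - W"
  shows "f (u(j := a)) = f (v(j := a))"
proof -
  have W: "W \<subseteq> I" "finite W"
    using E sep finite_subset by (auto simp: rel_separated_def)
  have "rel_connected (face_edge b W u) W"
    using conn by (rule rel_connected_mono) (rule face_edge_restrict [OF E \<open>b \<noteq> 0\<close> sep _ _ _ uv(1)])
  then have "reachable b W u v"
    using uv by (intro reachable_level_set [OF \<open>b \<noteq> 0\<close> W]) auto
  then show ?thesis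
    using increment_reachable [OF E(1) sep j uv(1)] uv(3) by (metis add_right_cancel)
qed

theorem splits_of_separated:
  assumes E: "E \<subseteq> I" "finite E" and "b \<noteq> 0" and sep: "rel_separated (face_edge b E z) E W"
    and conn: "rel_connected (face_edge b E z) W"
  shows "splits f E z W"
  unfolding splits_def
proof (intro ballI impI)
  fix x y w assume xy: "x \<in> face E z" "y \<in> face W x" "f x = f y" and w: "w \<in> face E z"
  have "f (override_on x w A) = f (override_on y w A)" if "A \<subseteq> E - W" for A
    using finite_subset [OF that finite_Diff [OF E(2)]] that
  proof (induction A rule: finite_induct)
    case (insert j A)
    have faces: "override_on x w A \<in> face E z" "override_on y w A \<in> face W (override_on x w A)"
      using insert.prems xy(1,2) by (auto simp: face_def override_on_def)
    show ?case
      unfolding override_on_insert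
      by (rule level_set_upd [OF E \<open>b \<noteq> 0\<close> sep conn faces]) (use insert in auto)
  qed (use xy in simp)
  moreover have "override_on x w (E - W) = override_on w x W"
      "override_on y w (E - W) = override_on w y W"
    using xy(1,2) w sep by (auto simp: face_def override_on_def rel_separated_def fun_eq_iff)
  ultimately show "f (override_on w x W) = f (override_on w y W)"
    by (metis subset_refl)
qed

section \<open>Gluing disconnected slices\<close>

definition slice_edge :: "klein4 \<Rightarrow> 'i set \<Rightarrow> ('i \<Rightarrow> klein4) \<Rightarrow> 'i \<Rightarrow> klein4 \<Rightarrow> 'i \<Rightarrow> 'i \<Rightarrow> bool" where
  "slice_edge b E z k v = face_edge b (E - {k}) (z(k := v))"

lemma slice_edge_iff:
  "k \<in> E \<Longrightarrow> slice_edge b E z k v i j \<longleftrightarrow> (\<exists>x\<in>face E z. x k = v \<and> edge b x i j)"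
  by (auto simp: slice_edge_def face_edge_def face_slice_iff)

lemma slice_edge_sym: "i \<in> I \<Longrightarrow> j \<in> I \<Longrightarrow> slice_edge b E z k v i j \<Longrightarrow> slice_edge b E z k v j i"
  unfolding slice_edge_def by (rule face_edge_sym)

lemma slice_edge_change_slice:
  assumes "E \<subseteq> I" "b \<noteq> 0" "k \<in> E" "rel_separated (slice_edge b E z k v) (E - {k}) W"
    and "l \<in> E - {k}" "l \<notin> W" "i \<in> W" "j \<in> W" "slice_edge b E z k v i j"
  shows "slice_edge b E z l u i j"
proof -
  obtain x where x: "x \<in> face E z" "x k = v" "edge b x i j"
    using assms(9) slice_edge_iff [OF assms(3)] by blast
  have "edge b (x(l := u)) i j \<longleftrightarrow> edge b x i j"
  proof (rule edge_upd_iff)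
    show "x \<in> face (E - {k}) (z(k := v))"
      using x assms(3) by (simp add: face_slice_iff)
    show "\<not> face_edge b (E - {k}) (z(k := v)) i l"
      using assms(4-7) by (simp add: rel_separated_def slice_edge_def)
  qed (use assms in \<open>auto simp: rel_separated_def\<close>)
  then show ?thesis
    using x assms(5) slice_edge_iff [of l E b z u i j] by (auto intro!: bexI [of _ "x(l := u)"])
qed

lemma rel_separated_of_slice:
  assumes "E \<subseteq> I" "b \<noteq> 0" "k \<in> E" "rel_separated (slice_edge b E z k v) (E - {k}) W"
    and "\<And>i. i \<in> W \<Longrightarrow> \<not> face_edge b E z i k"
  shows "rel_separated (face_edge b E z) E W"
  unfolding rel_separated_def
proof (intro conjI ballI notI)
  show W: "W \<subseteq> E"
    using assms(4) by (auto simp: rel_separated_def)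
  fix i j assume ij: "i \<in> W" "j \<in> E - W" "face_edge b E z i j"
  then have "i \<noteq> k" "j \<noteq> k"
    using assms(4,5) by (auto simp: rel_separated_def)
  obtain x where x: "x \<in> face E z" "edge b x i j"
    using ij(3) by (auto simp: face_edge_def)
  have "edge b (x(k := v)) i j"
    using edge_upd_iff [of i E j k b x z v] assms(1-3,5) W ij x \<open>i \<noteq> k\<close> by auto
  then have "slice_edge b E z k v i j"
    unfolding slice_edge_iff [OF assms(3)] using x(1) assms(3)
    by (intro bexI [of _ "x(k := v)"]) auto
  then show False
    using assms(4) ij \<open>j \<noteq> k\<close> by (auto simp: rel_separated_def)
qed

definition slice_component :: "klein4 \<Rightarrow> 'i set \<Rightarrow> ('i \<Rightarrow> klein4) \<Rightarrow> 'i \<Rightarrow> klein4 \<Rightarrow> 'i \<Rightarrow> 'i set" where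
  "slice_component b E z k v = rel_component (slice_edge b E z k v) (E - {k})"

lemma rel_separated_slice_component:
  "w \<in> E - {k} \<Longrightarrow> rel_separated (slice_edge b E z k v) (E - {k}) (slice_component b E z k v w)"
  unfolding slice_component_def by (rule rel_separated_component)

lemma slice_component_subset: "w \<in> E - {k} \<Longrightarrow> slice_component b E z k v w \<subseteq> E - {k}"
  unfolding slice_component_def by (rule rel_component_subset)

lemma ex_maximal_slice_component:
  assumes "finite E" "k \<in> E" "l \<in> E - {k}"
  obtains k v w where "k \<in> E" "w \<in> E - {k}" "\<And>k' v' w'. k' \<in> E \<Longrightarrow> w' \<in> E - {k'} \<Longrightarrow>
    slice_component b E z k v w \<subseteq> slice_component b E z k' v' w' \<Longrightarrow>
    slice_component b E z k' v' w' = slice_component b E z k v w"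
proof -
  define \<C> where "\<C> = {W. \<exists>k\<in>E. \<exists>v. \<exists>w\<in>E - {k}. W = slice_component b E z k v w}"
  have "\<C> \<subseteq> Pow E"
    using slice_component_subset unfolding \<C>_def by blast
  then have "finite \<C>"
    using assms(1) finite_subset by blast
  have "slice_component b E z k 0 l \<in> \<C>"
    using assms(2,3) unfolding \<C>_def by blast
  from finite_has_maximal2 [OF \<open>finite \<C>\<close> this]
  obtain W where "W \<in> \<C>" and maximal: "\<forall>W'\<in>\<C>. W \<subseteq> W' \<longrightarrow> W = W'"
    by blast
  then obtain k v w where kw: "k \<in> E" "w \<in> E - {k}" "W = slice_component b E z k v w"
    by (auto simp: \<C>_def)
  show ?thesis
  proof (rule that [OF kw(1,2)])
    fix k' v' w' assume "k' \<in> E" "w' \<in> E - {k'}"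
    then have "slice_component b E z k' v' w' \<in> \<C>"
      unfolding \<C>_def by blast
    then show "slice_component b E z k v w \<subseteq> slice_component b E z k' v' w' \<Longrightarrow>
        slice_component b E z k' v' w' = slice_component b E z k v w"
      using maximal kw(3) by metis
  qed
qed

lemma slice_component_change_slice:
  assumes "E \<subseteq> I" "b \<noteq> 0" "k \<in> E" "w \<in> E - {k}" "l \<in> E - {k}" "l \<notin> slice_component b E z k v w"
  shows "slice_component b E z k v w \<subseteq> slice_component b E z l u w"
proof -
  let ?W = "slice_component b E z k v w"
  have sep: "rel_separated (slice_edge b E z k v) (E - {k}) ?W" and "w \<in> ?W"
    using rel_separated_slice_component [OF assms(4)] by (simp_all add: slice_component_def)
  have "slice_edge b E z k v j i" if "i \<in> E - {k}" "j \<in> E - {k}" "slice_edge b E z k v i j" for i j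
    using that assms(1) slice_edge_sym by blast
  then have "rel_connected (slice_edge b E z k v) ?W"
    unfolding slice_component_def using assms(4) by (rule rel_connected_component)
  then have "rel_connected (slice_edge b E z l u) ?W"
    by (rule rel_connected_mono) (use slice_edge_change_slice [OF assms(1-3) sep assms(5,6)] in blast)
  moreover have "?W \<subseteq> E - {l}"
    using sep assms(6) by (auto simp: rel_separated_def)
  ultimately show ?thesis
    unfolding slice_component_def [of _ _ _ l] using \<open>w \<in> ?W\<close>
    by (rule rel_connected_subset_component)
qed

text \<open>A component \<open>W\<close> that is maximal among the components of all slices is also a component of every
  slice in a direction \<open>l\<close> outside \<open>W\<close>, and therefore not joined to \<open>k\<close> either.\<close>

theorem not_rel_connected_of_slices:
  assumes E: "E \<subseteq> I" "finite E" "E \<noteq> {}" and "b \<noteq> 0"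
    and slices: "\<And>k v. k \<in> E \<Longrightarrow> \<not> rel_connected (slice_edge b E z k v) (E - {k})"
  shows "\<not> rel_connected (face_edge b E z) E"
proof -
  obtain k0 where k0: "k0 \<in> E"
    using E(3) by blast
  then have "E - {k0} \<noteq> {}"
    using slices [OF k0] rel_connected_empty by metis
  then obtain l0 where "l0 \<in> E - {k0}" by blast
  then obtain k v w where k: "k \<in> E" "w \<in> E - {k}" and maximal: "\<And>k' v' w'. k' \<in> E \<Longrightarrow>
      w' \<in> E - {k'} \<Longrightarrow> slice_component b E z k v w \<subseteq> slice_component b E z k' v' w' \<Longrightarrow>
      slice_component b E z k' v' w' = slice_component b E z k v w"
    using ex_maximal_slice_component [OF E(2) k0] by metis
  define W where "W = slice_component b E z k v w"
  have sep: "rel_separated (slice_edge b E z k v) (E - {k}) W"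
    unfolding W_def using k(2) by (rule rel_separated_slice_component)
  then have sub: "W \<subseteq> E - {k}" "w \<in> W"
    by (simp_all add: W_def rel_separated_def slice_component_def)
  have "W \<noteq> E - {k}"
    unfolding W_def slice_component_def
    by (rule rel_component_neq) (use slices [OF k(1)] k(2) E(1) slice_edge_sym in blast)+
  then obtain l where l: "l \<in> E - {k}" "l \<notin> W" "l \<in> E"
    using sub(1) by blast
  have same_component: "slice_component b E z l u w = W" for u
    using maximal [of l w u] slice_component_change_slice [OF E(1) \<open>b \<noteq> 0\<close> k l(1)] l sub
    unfolding W_def by blast
  have "\<not> face_edge b E z i k" if i: "i \<in> W" for i
  proof
    assume "face_edge b E z i k"
    then obtain x where x: "x \<in> face E z" "edge b x i k"
      by (auto simp: face_edge_def)
    then have "slice_edge b E z l (x l) i k"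
      using l(3) slice_edge_iff by blast
    moreover have "rel_separated (slice_edge b E z l (x l)) (E - {l}) W"
      using rel_separated_slice_component [of w E l b z "x l"] same_component [of "x l"] sub l(2)
      by auto
    ultimately show False
      using i k(1) l(1) sub(1) by (auto simp: rel_separated_def)
  qed
  then have "rel_separated (face_edge b E z) E W"
    by (rule rel_separated_of_slice [OF E(1) \<open>b \<noteq> 0\<close> k(1) sep])
  then show ?thesis
    using sub k(1) unfolding rel_connected_def by blast
qed

section \<open>Obstructions\<close>

lemma not_complementary_paths:
  assumes I: "{p, q, r, s} \<subseteq> I" and "distinct [p, q, r, s]" and a: "a \<noteq> 0" "outside a e"
  shows "\<not> complementary_paths (\<lambda>i j. colour i j x) a e p q r s"
proof
  assume "complementary_paths (\<lambda>i j. colour i j x) a e p q r s"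
  then have c: "colour p q x = a" "colour q r x = a" "colour r s x = a"
      "colour q s x = e" "colour p s x = e" "colour p r x = e"
    by (simp_all add: complementary_paths_def)
  let ?y = "move r e x"
  have e: "e \<noteq> 0" "outside e a"
    using a by (auto simp: outside_def)
  have ne: "p \<noteq> q" "p \<noteq> r" "p \<noteq> s" "q \<noteq> p" "q \<noteq> r" "q \<noteq> s" "s \<noteq> r"
    using assms(2) by auto
  have "colour q s ?y = a + e"
    using colour_move_toggle [of q s r x a e] I ne a c colour_sym [of r s x] by simp
  moreover have "colour p q ?y = a"
    using colour_move_stable [of q p r x a e] I ne a c colour_sym [of p q x] colour_sym [of p q ?y]
    by simp
  moreover have "colour p s ?y = e"
    using colour_move_stable [of p s r x e e] I ne c e colour_sym [of r s x] by simp
  ultimately show False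
    using colour_not_rainbow [of p q s ?y] I ne a e by (auto simp: outside_def)
qed

lemma ex_disconnected_edge_label:
  assumes "Y \<subseteq> I" "finite Y" "2 \<le> card Y"
  shows "\<exists>b. b \<noteq> 0 \<and> \<not> rel_connected (edge b x) Y"
proof (rule gallai_ex_disconnected_label [OF gallai_colour [OF assms(1)] assms(2,3)])
  show "\<not> complementary_paths (\<lambda>i j. colour i j x) a e p q r s"
    if "{p, q, r, s} \<subseteq> Y" "distinct [p, q, r, s]" "a \<noteq> 0" "outside a e" for a e p q r s
    using not_complementary_paths [OF subset_trans [OF that(1) assms(1)] that(2-4)] .
qed

definition obstruction :: "klein4 \<Rightarrow> ('i \<Rightarrow> klein4) \<Rightarrow> 'i set \<Rightarrow> bool" where
  "obstruction b x Y \<longleftrightarrow> b \<noteq> 0 \<and> 2 \<le> card Y \<and> rel_connected (edge 0 x) Y \<and> \<not> rel_connected (edge b x) Y"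

definition maximal_obstruction ::
    "'i set \<Rightarrow> ('i \<Rightarrow> klein4) \<Rightarrow> klein4 \<Rightarrow> ('i \<Rightarrow> klein4) \<Rightarrow> 'i set \<Rightarrow> bool" where
  "maximal_obstruction E z b x Y \<longleftrightarrow> x \<in> face E z \<and> Y \<subseteq> E \<and> obstruction b x Y \<and>
    (\<forall>x'\<in>face E z. \<forall>b' Y'. obstruction b' x' Y' \<longrightarrow> Y \<subseteq> Y' \<longrightarrow> Y' \<subseteq> E \<longrightarrow> Y' = Y)"

lemma obstruction_pair:
  assumes "i \<in> I" "j \<in> I" "i \<noteq> j" "colour i j x \<noteq> 0"
  shows "obstruction (colour i j x) x {i, j}"
proof -
  have "edge 0 x i j"
    using assms(3,4) by (simp add: colour_edge_def outside_def)
  then have "rel_connected (edge 0 x) {i, j}"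
    using edge_sym assms(1-3) by (intro rel_connected_pair) auto
  moreover have "\<not> rel_connected (edge (colour i j x) x) {i, j}"
    using assms(3) by (intro not_rel_connected_colour_edge_pair) simp_all
  ultimately show ?thesis
    using assms(3,4) by (simp add: obstruction_def)
qed

lemma ex_maximal_obstruction:
  assumes "E \<subseteq> I" "finite E" "2 \<le> card E" "rel_connected (face_edge b E z) E"
  shows "\<exists>b x Y. maximal_obstruction E z b x Y"
proof -
  define \<Y> where "\<Y> = {Y. Y \<subseteq> E \<and> (\<exists>x\<in>face E z. \<exists>b. obstruction b x Y)}"
  obtain i where i: "i \<in> E"
    using assms(3) by fastforce
  moreover have "{i} \<noteq> E"
    using assms(3) by auto
  ultimately obtain j where j: "j \<in> E" "j \<noteq> i" "face_edge b E z i j"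
    using rel_connectedE [OF assms(4), of "{i}"] by auto
  then obtain x where x: "x \<in> face E z" "edge b x i j"
    by (auto simp: face_edge_def)
  then have "obstruction (colour i j x) x {i, j}"
    using i j assms(1) by (intro obstruction_pair) (auto simp: colour_edge_def outside_def)
  then have pair: "{i, j} \<in> \<Y>"
    using i j x(1) by (auto simp: \<Y>_def)
  have "finite \<Y>"
    by (rule finite_subset [of _ "Pow E"]) (use assms(2) in \<open>auto simp: \<Y>_def\<close>)
  from finite_has_maximal2 [OF this pair] obtain Y
    where Y: "Y \<in> \<Y>" and maximal: "\<And>Y'. Y' \<in> \<Y> \<Longrightarrow> Y \<subseteq> Y' \<Longrightarrow> Y' = Y"
    by metis
  from Y obtain y a where "y \<in> face E z" "Y \<subseteq> E" "obstruction a y Y"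
    by (auto simp: \<Y>_def)
  moreover have "Y' = Y" if "x' \<in> face E z" "obstruction b' x' Y'" "Y \<subseteq> Y'" "Y' \<subseteq> E" for x' b' Y'
    using maximal [of Y'] that by (auto simp: \<Y>_def)
  ultimately have "maximal_obstruction E z a y Y"
    by (simp add: maximal_obstruction_def)
  then show ?thesis by blast
qed

lemma maximal_obstruction_isolated:
  assumes "E \<subseteq> I" "finite E" "maximal_obstruction E z b x Y" "i \<in> Y" "j \<in> E - Y"
  shows "colour i j x = 0"
proof (rule ccontr)
  have Y: "x \<in> face E z" "Y \<subseteq> E" "2 \<le> card Y" "rel_connected (edge 0 x) Y"
    using assms(3) by (auto simp: maximal_obstruction_def obstruction_def)
  assume "colour i j x \<noteq> 0"
  then have "edge 0 x i j"
    using assms(4,5) by (auto simp: colour_edge_def outside_def)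
  moreover from this have "edge 0 x j i"
    using edge_sym assms(1,4,5) Y(2) by blast
  ultimately have connected: "rel_connected (edge 0 x) (insert j Y)"
    using Y(4) assms(4,5) by (intro rel_connected_insert [of _ Y i j]) auto
  have sub: "insert j Y \<subseteq> E"
    using Y(2) assms(5) by blast
  then have "insert j Y \<subseteq> I" "finite (insert j Y)" and card: "2 \<le> card (insert j Y)"
    using Y(3) assms(1,2,5) finite_subset [OF Y(2)] by auto
  then obtain a where "a \<noteq> 0" "\<not> rel_connected (edge a x) (insert j Y)"
    using ex_disconnected_edge_label by blast
  then have "obstruction a x (insert j Y)"
    using connected card by (simp add: obstruction_def)
  then have "insert j Y = Y"
    using assms(3) Y(1) sub unfolding maximal_obstruction_def by blast
  then show False
    using assms(5) by blast
qed

text \<open>The edges of colour \<open>b\<close> between different components survive moves of type \<open>b\<close>. They connect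
  \<open>Y\<close> in every other label, so \<open>b\<close> remains the disconnected one.\<close>

lemma obstruction_move:
  assumes "Y \<subseteq> I" "finite Y" "j \<in> I" "obstruction b x Y"
    and isolated: "\<And>i. i \<in> Y \<Longrightarrow> j \<notin> Y \<Longrightarrow> colour i j x = 0"
  shows "obstruction b (move j b x) Y"
proof -
  interpret gallai "\<lambda>i j. colour i j x" Y
    using assms(1) by (rule gallai_colour)
  have b: "b \<noteq> 0" "2 \<le> card Y"
    using assms(4) by (simp_all add: obstruction_def)
  have persist: "colour u v (move j b x) = b" if uv: "u \<in> Y" "v \<in> Y" "cross_edge b u v" for u v
  proof (rule colour_move_persist)
    show "\<not> outside b (colour u j x) \<or> \<not> outside b (colour v j x)"
    proof (cases "j \<in> Y")
      case True
      then show ?thesis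
        using label_component_eq_of_outside uv by (metis cross_edge_def)
    qed (simp add: isolated uv(1))
  qed (use uv assms(1,3) b cross_edge_irrefl in \<open>auto simp: cross_edge_def\<close>)
  have "rel_connected (cross_edge b) Y"
    using assms(4) by (intro rel_connected_cross_edge) (simp_all add: obstruction_def)
  then have connected: "rel_connected (edge a (move j b x)) Y" if "a \<noteq> b" for a
    by (rule rel_connected_mono)
      (use that b persist cross_edge_irrefl in \<open>auto simp: colour_edge_def outside_def\<close>)
  obtain a where "a \<noteq> 0" "\<not> rel_connected (edge a (move j b x)) Y"
    using ex_disconnected_edge_label assms(1,2) b(2) by blast
  then have "\<not> rel_connected (edge b (move j b x)) Y"
    using connected by metis
  then show ?thesis
    using connected [of 0] b by (simp add: obstruction_def)
qed

lemma maximal_obstruction_reachable: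
  assumes "E \<subseteq> I" "finite E" "reachable b E x y" "maximal_obstruction E z b x Y"
  shows "maximal_obstruction E z b y Y"
  using assms(3)
proof (induction rule: reachable_induct)
  case (step w j)
  have "Y \<subseteq> E" "obstruction b w Y"
    using step.IH by (simp_all add: maximal_obstruction_def)
  then have "obstruction b (move j b w) Y"
    using maximal_obstruction_isolated [OF assms(1,2) step.IH] step.hyps(2) assms(1,2) finite_subset
    by (intro obstruction_move) auto
  then show ?case
    using step by (auto simp: maximal_obstruction_def)
qed (rule assms(4))

lemma maximal_obstruction_level_set:
  assumes "E \<subseteq> I" "finite E" "rel_connected (face_edge b E z) E" "maximal_obstruction E z b x Y"
    and "y \<in> face E z" "\<not> outside b (f x + f y)"
  shows "maximal_obstruction E z b y Y"
proof -
  have "b \<noteq> 0" "x \<in> face E z"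
    using assms(4) by (auto simp: maximal_obstruction_def obstruction_def)
  then have "reachable b E x y"
    using reachable_level_set assms by blast
  then show ?thesis
    using maximal_obstruction_reachable assms(1,2,4) by blast
qed

lemma maximal_obstruction_full:
  assumes "E \<subseteq> I" "finite E" "rel_connected (face_edge b E z) E" "maximal_obstruction E z b x Y"
  shows "Y = E"
proof (rule ccontr)
  assume "Y \<noteq> E"
  moreover have "Y \<subseteq> E" "Y \<noteq> {}"
    using assms(4) by (auto simp: maximal_obstruction_def obstruction_def)
  ultimately obtain i j where ij: "i \<in> Y" "j \<in> E" "j \<notin> Y" "face_edge b E z i j"
    using rel_connectedE [OF assms(3), of Y] by metis
  then obtain w where w: "w \<in> face E z" "edge b w i j"
    by (auto simp: face_edge_def)
  have I: "i \<in> E" "i \<in> I" "j \<in> I" "i \<noteq> j"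
    using ij \<open>Y \<subseteq> E\<close> assms(1) by auto
  let ?w = "move i (f w + f x) w"
  have "maximal_obstruction E z b ?w Y"
    using w(1) I by (intro maximal_obstruction_level_set [OF assms]) (auto simp: ac_simps)
  then have "colour i j ?w = 0"
    using maximal_obstruction_isolated assms(1,2) ij by blast
  then show False
    using w(2) I by (simp add: colour_edge_def)
qed

end

section \<open>Obstructed slices\<close>

context gallai
begin

context
  fixes b k A
  assumes k: "k \<in> Y" and label: "b \<noteq> 0"
    and connected: "rel_connected (colour_edge c 0) Y"
    and disconnected: "\<not> rel_connected (colour_edge c b) Y"
    and side: "A \<subseteq> Y - {k}"
    and between: "\<And>i j. i \<in> A \<Longrightarrow> j \<in> Y - {k} - A \<Longrightarrow> c i j \<noteq> b"
begin

lemma cross_edge_component_meeting_both_sides: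
  assumes "p \<in> A" "q \<in> Y - {k} - A" "label_component b q = label_component b p"
    and "w \<in> Y" "cross_edge b p w"
  shows "w = k"
proof (rule ccontr)
  assume "w \<noteq> k"
  have "p \<in> Y" "q \<in> Y"
    using assms(1,2) side by auto
  have "cross_edge b q w"
    using cross_edge_component_left [OF label _ assms(4,5), of q] assms(3)
    by (metis rel_component_self)
  then have "c p w = b" "c w q = b"
    using assms(5) cross_edge_sym [OF \<open>q \<in> Y\<close> assms(4)] by (auto simp: cross_edge_def)
  then show False
    using between [of p w] between [of w q] assms(1,2,4) \<open>w \<noteq> k\<close> by blast
qed

lemma colour_vertex_of_component_meeting_both_sides:
  assumes "p \<in> A" "q \<in> Y - {k} - A" "label_component b q = label_component b p"
  shows "c p k = b" "c q k = b" "t \<in> Y - {k} \<Longrightarrow> \<not> outside b (c k t)"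
proof -
  have "p \<in> Y"
    using assms(1) side by blast
  obtain w where "w \<in> Y" "cross_edge b p w"
    using ex_cross_edge [OF connected disconnected label \<open>p \<in> Y\<close>] by blast
  then have pk: "cross_edge b p k"
    using cross_edge_component_meeting_both_sides [OF assms] by metis
  moreover have "cross_edge b q k"
    using cross_edge_component_left [OF label _ k pk, of q] assms(3) by (metis rel_component_self)
  ultimately show "c p k = b" "c q k = b"
    by (simp_all add: cross_edge_def)
  show "\<not> outside b (c k t)" if t: "t \<in> Y - {k}"
  proof
    assume "outside b (c k t)"
    then have "label_component b t = label_component b k"
      using label_component_eq_of_outside k t by blast
    then have "cross_edge b p t"
      using cross_edge_components [OF label \<open>p \<in> Y\<close> k pk] by (metis rel_component_self)
    then show False
      using cross_edge_component_meeting_both_sides [OF assms] t by blast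
  qed
qed

lemma not_outside_colour_vertex:
  assumes "p \<in> A" "c p k = b" "q \<in> Y - {k} - A" "c q k = b" "t \<in> Y - {k}"
  shows "\<not> outside b (c k t)"
proof
  assume outside: "outside b (c k t)"
  have Y: "p \<in> Y - {k}" "q \<in> Y - {k}"
    using assms(1,3) side by auto
  have tk: "c t k = c k t" "c t k \<noteq> b"
    using colour_sym [of t k] assms(5) k outside by (auto simp: outside_def)
  then have ne: "t \<noteq> p" "t \<noteq> q"
    using assms(2,4) by auto
  show False
  proof (cases "t \<in> A")
    case True
    then have "c t q = c k t"
      using not_rainbow [of t q k] between [of t q] assms Y ne tk k by auto
    then have "label_component b q = label_component b t"
      using label_component_eq_of_outside [of t q b] assms(5) Y outside by simp
    then show False
      using colour_vertex_of_component_meeting_both_sides(3) [OF True assms(3)] assms(5) outside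
      by blast
  next
    case False
    then have "c p t = c k t"
      using not_rainbow [of p t k] between [of p t] assms Y ne tk k by auto
    then have "label_component b t = label_component b p"
      using label_component_eq_of_outside [of p t b] assms(5) Y outside by simp
    then show False
      using colour_vertex_of_component_meeting_both_sides(3) [OF assms(1)] assms(5) False outside
      by blast
  qed
qed

end

end

context latin4
begin

context
  fixes F k b a A z x
  assumes new: "k \<notin> F" and coordinates: "insert k F \<subseteq> I" "finite F" and labels: "b \<noteq> 0" "a \<noteq> b"
    and side: "rel_separated (face_edge a F z) F A"
    and obstructed: "\<And>y. y \<in> face F z \<Longrightarrow> \<not> outside b (f x + f y) \<Longrightarrow> obstruction b y (insert k F)"
begin

lemma colour_between_sides:
  assumes "y \<in> face F z" "i \<in> A" "j \<in> F - A"
  shows "colour i j y \<noteq> b"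
proof -
  have "\<not> edge a y i j"
    using side assms by (auto simp: rel_separated_def face_edge_def)
  then show ?thesis
    using labels assms(2,3) by (auto simp: colour_edge_def outside_def)
qed

lemma colours_to_new_of_edge:
  assumes "y \<in> face F z" "\<not> outside b (f x + f y)" "p \<in> A" "q \<in> F - A" "edge b y p q"
  shows "colour p k y = b" "colour q k y = b"
proof -
  interpret gallai "\<lambda>i j. colour i j y" "insert k F"
    using coordinates(1) by (rule gallai_colour)
  have "p \<in> F"
    using side assms(3) by (auto simp: rel_separated_def)
  then have "label_component b q = label_component b p"
    using label_component_eq_of_outside [of p q b] assms(4,5) by (simp add: colour_edge_def)
  moreover have "A \<subseteq> insert k F - {k}"
    using side new by (auto simp: rel_separated_def)
  ultimately show "colour p k y = b" "colour q k y = b"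
    using colour_vertex_of_component_meeting_both_sides(1,2) [of k b A p q]
      obstructed [OF assms(1,2)] colour_between_sides [OF assms(1)] assms(3,4) labels(1) new
    by (auto simp: obstruction_def)
qed

lemma not_outside_colour_new:
  assumes "y \<in> face F z" "\<not> outside b (f x + f y)" "p \<in> A" "colour p k y = b"
    and "q \<in> F - A" "colour q k y = b" "t \<in> F"
  shows "\<not> outside b (colour k t y)"
proof -
  interpret gallai "\<lambda>i j. colour i j y" "insert k F"
    using coordinates(1) by (rule gallai_colour)
  have "A \<subseteq> insert k F - {k}"
    using side new by (auto simp: rel_separated_def)
  then show ?thesis
    using not_outside_colour_vertex [of k b A p q t] obstructed [OF assms(1,2)]
      colour_between_sides [OF assms(1)] assms(3-) labels(1) new
    by (auto simp: obstruction_def)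
qed

lemma colours_to_new_reachable:
  assumes "reachable b F y y'" "y \<in> face F z" "\<not> outside b (f x + f y)"
    and "p \<in> A" "colour p k y = b" "q \<in> F - A" "colour q k y = b"
  shows "\<not> outside b (f x + f y') \<and> colour p k y' = b \<and> colour q k y' = b"
  using assms(1)
proof (induction rule: reachable_induct)
  case (step w j)
  have w: "w \<in> face F z"
    using reachable_face [OF step.hyps(1) assms(2)] .
  have F: "p \<in> F" "q \<in> F"
    using side assms(4,6) by (auto simp: rel_separated_def)
  have "\<not> outside b (colour k j w)"
    using not_outside_colour_new [OF w] step assms(4,6) by blast
  then have "colour s k (move j b w) = b" if "s \<in> F" "colour s k w = b" for s
    using that step.hyps(2) new coordinates(1) labels(1)
    by (intro colour_move_persist) (auto simp: colour_sym)
  moreover have "\<not> outside b (f x + f (move j b w))"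
    using step coordinates(1) labels(1) by (auto simp: outside_add simp flip: add.assoc)
  ultimately show ?case
    using step.IH F by blast
qed (use assms in simp)

lemma not_outside_colour_new_level_set:
  assumes "rel_connected (face_edge b F z) F" "A \<noteq> {}" "A \<noteq> F"
    and "y \<in> face F z" "\<not> outside b (f x + f y)" "t \<in> F"
  shows "\<not> outside b (colour k t y)"
proof -
  have "A \<subseteq> F"
    using side by (simp add: rel_separated_def)
  then obtain p q where pq: "p \<in> A" "q \<in> F" "q \<notin> A" "face_edge b F z p q"
    by (rule rel_connectedE [OF assms(1) _ assms(2,3)])
  then obtain w where w: "w \<in> face F z" "edge b w p q"
    by (auto simp: face_edge_def)
  define y0 where "y0 = move p (f w + f x) w"
  have I: "p \<in> F" "p \<in> I" "q \<in> I" "p \<noteq> q"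
    using pq \<open>A \<subseteq> F\<close> coordinates(1) by auto
  then have y0: "y0 \<in> face F z" "f y0 = f x" "edge b y0 p q"
    using w by (auto simp: y0_def colour_edge_def ac_simps)
  then have colours: "colour p k y0 = b" "colour q k y0 = b"
    using colours_to_new_of_edge [OF y0(1) _ pq(1)] pq(2,3) by simp_all
  have "reachable b F y0 y"
    using coordinates assms(5) y0(2)
    by (intro reachable_level_set [OF labels(1) _ _ assms(1) y0(1) assms(4)]) auto
  then have "colour p k y = b" "colour q k y = b"
    using colours_to_new_reachable [OF _ y0(1) _ pq(1) colours(1) _ colours(2)] y0(2) pq(2,3)
    by simp_all
  then show ?thesis
    using not_outside_colour_new [OF assms(4,5) pq(1)] pq(2,3) assms(6) by blast
qed

theorem not_rel_connected_of_obstructed_slice: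
  assumes "rel_connected (face_edge b F z) F" "A \<noteq> {}" "A \<noteq> F"
  shows "\<not> rel_connected (face_edge b (insert k F) z) (insert k F)"
proof -
  have "\<not> face_edge b (insert k F) z k t" if t: "t \<in> F" for t
  proof
    assume "face_edge b (insert k F) z k t"
    then obtain w where w: "w \<in> face (insert k F) z" "edge b w k t"
      by (auto simp: face_edge_def)
    have I: "k \<in> I" "t \<in> I" "k \<noteq> t"
      using coordinates(1) t new by auto
    define y where "y = move t (f (w(k := z k)) + f x) (w(k := z k))"
    have "w(k := z k) \<in> face F z"
      using w(1) by (auto simp: face_def)
    then have "y \<in> face F z" "f y = f x"
      using t I by (auto simp: y_def ac_simps)
    then have "\<not> outside b (colour k t y)"
      using not_outside_colour_new_level_set [OF assms _ _ t] by simp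
    then show False
      using w(2) I by (simp add: y_def colour_edge_def)
  qed
  then have "rel_separated (face_edge b (insert k F) z) (insert k F) {k}"
    by (auto simp: rel_separated_def)
  moreover have "F \<noteq> {}"
    using side assms(2) by (auto simp: rel_separated_def)
  ultimately show ?thesis
    using new unfolding rel_connected_def by blast
qed

end

lemma ex_disconnected_face_edge_label_pair:
  assumes "E \<subseteq> I" "card E = 2"
  shows "\<exists>b. b \<noteq> 0 \<and> \<not> rel_connected (face_edge b E z) E"
proof -
  obtain i j where ij: "E = {i, j}" "i \<noteq> j"
    using assms(2) by (meson card_2_iff)
  have edge_face: "edge b z u v" if "x \<in> face E z" "u \<in> E" "v \<in> E" "edge b x u v" for b x u v
  proof -
    have "x = z(i := x i, j := x j)"
      using that(1) by (auto simp: face_def ij fun_eq_iff)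
    then have "colour i j x = colour i j z"
      using assms(1) ij by (metis colour_upd insert_subset)
    moreover from this have "colour j i x = colour j i z"
      using assms(1) ij colour_sym by (metis insert_subset)
    ultimately show ?thesis
      using that(2-4) ij by (auto simp: colour_edge_def)
  qed
  obtain b where "b \<noteq> 0" "\<not> rel_connected (edge b z) E"
    using ex_disconnected_edge_label [of E z] assms ij by auto
  moreover have "rel_connected (edge b z) E" if "rel_connected (face_edge b E z) E"
    using that by (rule rel_connected_mono) (auto simp: face_edge_def intro: edge_face)
  ultimately show ?thesis by blast
qed

lemma not_rel_connected_slice:
  assumes E: "E \<subseteq> I" "finite E" and "b \<noteq> 0" "k \<in> E" and connected: "rel_connected (face_edge b E z) E"
    and obstructed: "\<And>y. y \<in> face E z \<Longrightarrow> \<not> outside b (f x + f y) \<Longrightarrow> obstruction b y E"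
    and a: "\<not> rel_connected (slice_edge a E z k v) (E - {k})"
  shows "\<not> rel_connected (slice_edge b E z k v) (E - {k})"
proof
  let ?F = "E - {k}" and ?z = "z(k := v)"
  assume slice: "rel_connected (slice_edge b E z k v) ?F"
  then have "a \<noteq> b"
    using a by blast
  obtain A where A: "rel_separated (face_edge a ?F ?z) ?F A" "A \<noteq> {}" "A \<noteq> ?F"
    using a by (auto simp: rel_connected_def slice_edge_def)
  have "\<not> rel_connected (face_edge b (insert k ?F) ?z) (insert k ?F)"
  proof (rule not_rel_connected_of_obstructed_slice [OF _ _ _ \<open>b \<noteq> 0\<close> \<open>a \<noteq> b\<close> A(1) _ _ A(2,3)])
    show "obstruction b y (insert k ?F)" if "y \<in> face ?F ?z" "\<not> outside b (f x + f y)" for y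
      using obstructed that \<open>k \<in> E\<close> by (simp add: face_slice_iff insert_absorb)
    show "rel_connected (face_edge b ?F ?z) ?F"
      using slice by (simp add: slice_edge_def)
  qed (use \<open>k \<in> E\<close> E in auto)
  moreover have "face_edge b E ?z = face_edge b E z"
    using \<open>k \<in> E\<close> by (simp add: face_edge_def [abs_def] face_base_upd)
  ultimately show False
    using connected \<open>k \<in> E\<close> by (simp add: insert_absorb)
qed

theorem ex_disconnected_face_edge_label:
  assumes "E \<subseteq> I" "finite E" "2 \<le> card E"
  shows "\<exists>b. b \<noteq> 0 \<and> \<not> rel_connected (face_edge b E z) E"
  using assms
proof (induction "card E" arbitrary: E z rule: less_induct)
  case (less E)
  note E = less.prems(1,2)
  show ?case
  proof (rule ccontr)
    assume "\<not> ?thesis"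
    then have connected: "rel_connected (face_edge b E z) E" if "b \<noteq> 0" for b
      using that by blast
    then have "card E \<noteq> 2"
      using ex_disconnected_face_edge_label_pair [OF E(1)] by blast
    obtain b x Y where maximal: "maximal_obstruction E z b x Y"
      using ex_maximal_obstruction [OF less.prems connected [of K1]] by (auto simp: zero_klein4_def)
    then have b: "b \<noteq> 0"
      by (simp add: maximal_obstruction_def obstruction_def)
    have "Y = E"
      using maximal_obstruction_full [OF E connected [OF b] maximal] .
    then have obstructed: "obstruction b y E" if "y \<in> face E z" "\<not> outside b (f x + f y)" for y
      using maximal_obstruction_level_set [OF E connected [OF b] maximal that]
      by (simp add: maximal_obstruction_def)
    have "\<not> rel_connected (slice_edge b E z k v) (E - {k})" if k: "k \<in> E" for k v
    proof -
      have "card (E - {k}) < card E" "2 \<le> card (E - {k})"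
        using k E(2) less.prems(3) \<open>card E \<noteq> 2\<close> by auto
      then obtain a where "\<not> rel_connected (slice_edge a E z k v) (E - {k})"
        using less.hyps [of "E - {k}" "z(k := v)"] E by (auto simp: slice_edge_def)
      then show ?thesis
        using not_rel_connected_slice [OF E b k connected [OF b] obstructed] by blast
    qed
    then show False
      using not_rel_connected_of_slices [OF E _ b] less.prems(3) connected [OF b] by fastforce
  qed
qed

definition semilinear :: "klein4 \<Rightarrow> 'i set \<Rightarrow> ('i \<Rightarrow> klein4) \<Rightarrow> bool" where
  "semilinear b E z \<longleftrightarrow> (\<forall>i\<in>E. \<forall>j\<in>E. \<not> face_edge b E z i j)"

lemma splits_component:
  assumes "E \<subseteq> I" "finite E" "b \<noteq> 0" "i \<in> E"
  shows "splits f E z (rel_component (face_edge b E z) E i)"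
proof (rule splits_of_separated [OF assms(1-3) rel_separated_component [OF assms(4)]])
  have "face_edge b E z v u" if "u \<in> E" "v \<in> E" "face_edge b E z u v" for u v
    using that assms(1) face_edge_sym by blast
  then show "rel_connected (face_edge b E z) (rel_component (face_edge b E z) E i)"
    using assms(4) by (rule rel_connected_component)
qed

theorem semilinear_or_splits:
  assumes "E \<subseteq> I" "finite E" "2 \<le> card E"
  obtains (semilinear) b where "b \<noteq> 0" "semilinear b E z"
  | (split) W where "W \<subseteq> E" "W \<noteq> E" "2 \<le> card W" "splits f E z W"
proof -
  obtain b where b: "b \<noteq> 0" "\<not> rel_connected (face_edge b E z) E"
    using ex_disconnected_face_edge_label [OF assms] by blast
  show ?thesis
  proof (cases "semilinear b E z")
    case True
    then show ?thesis
      using semilinear b(1) by blast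
  next
    case False
    then obtain i j where ij: "i \<in> E" "j \<in> E" "face_edge b E z i j"
      by (auto simp: semilinear_def)
    define W where "W = rel_component (face_edge b E z) E i"
    have "{i, j} \<subseteq> W"
      using rel_component_step [of i "face_edge b E z" E i j] ij by (simp add: W_def)
    moreover have "i \<noteq> j"
      using ij(3) by (auto simp: face_edge_def colour_edge_def)
    moreover have "W \<subseteq> E"
      unfolding W_def using ij(1) by (rule rel_component_subset)
    moreover from this have "finite W"
      using assms(2) by (rule finite_subset)
    ultimately have "2 \<le> card W"
      using card_mono [of W "{i, j}"] by simp
    moreover have "W \<noteq> E"
      unfolding W_def
      by (rule rel_component_neq) (use b(2) ij(1) assms(1) face_edge_sym in blast)+
    moreover have "splits f E z W"
      unfolding W_def using assms(1,2) b(1) ij(1) by (rule splits_component)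
    ultimately show ?thesis
      using split \<open>W \<subseteq> E\<close> by blast
  qed
qed

end

section \<open>Transversals of semilinear functions\<close>

text \<open>For \<open>b \<noteq> 0\<close> these are 8 permutations that preserve the cosets of \<open>{0, b}\<close>.\<close>

definition shear :: "klein4 \<Rightarrow> klein4 \<times> bool \<Rightarrow> klein4 \<Rightarrow> klein4" where
  "shear b p u = fst p + u + (if snd p \<and> outside b u then b else 0)"

lemma shear_add_label: "b \<noteq> 0 \<Longrightarrow> shear b p (u + b) = shear b p u + b"
  by (simp add: shear_def outside_add ac_simps)

lemma outside_shear: "b \<noteq> 0 \<Longrightarrow> outside b (shear b p u + shear b p v) = outside b (u + v)"
  by (auto simp: shear_def outside_add)

lemma inj_shear_apply:
  assumes "b \<noteq> 0"
  shows "inj (shear b p)"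
proof (rule injI)
  fix u v assume eq: "shear b p u = shear b p v"
  then have "\<not> outside b (u + v)"
    using outside_shear [OF assms, of p u v] by simp
  then show "u = v"
    using not_outside_add_cases [of b u v] shear_add_label [OF assms, of p u] eq assms
    by (metis add.right_neutral add_left_cancel)
qed

lemma inj_shear:
  assumes "b \<noteq> 0"
  shows "inj (shear b)"
proof (rule injI)
  fix p q assume eq: "shear b p = shear b q"
  obtain c where "outside b c"
    using ex_outside by blast
  then show "p = q"
    using fun_cong [OF eq, of 0] fun_cong [OF eq, of c] assms
    by (cases p; cases q) (auto simp: shear_def split: if_splits)
qed

context latin4
begin

context
  fixes b E z
  assumes label: "b \<noteq> 0" and coordinates: "E \<subseteq> I" "finite E" and semilinear: "semilinear b E z"
begin

lemma semilinear_line: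
  assumes "i \<in> E" "w \<in> face E z"
  shows "outside b (f (w(i := v)) + f (w(i := v'))) = outside b (f (z(i := v)) + f (z(i := v')))"
proof (rule face_induct [OF coordinates(2) face_self assms(2)])
  fix w k t
  assume w: "w \<in> face E z" and k: "k \<in> E"
    and IH: "outside b (f (w(i := v)) + f (w(i := v'))) = outside b (f (z(i := v)) + f (z(i := v')))"
  show "outside b (f (w(k := t, i := v)) + f (w(k := t, i := v')))
      = outside b (f (z(i := v)) + f (z(i := v')))"
  proof (cases "k = i")
    case False
    have "w(i := v') \<in> face E z"
      using w assms(1) by blast
    then have "\<not> edge b (w(i := v')) i k"
      using semilinear assms(1) k by (auto simp: semilinear_def face_edge_def)
    then show ?thesis
      using not_edge_additive [of i k b "w(i := v')" v t] coordinates(1) assms(1) k False label IH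
      by (simp add: fun_upd_twist subset_iff)
  qed (use IH in simp)
qed simp

lemma semilinear_line_label:
  assumes "i \<in> E" "w \<in> face E z" "f (z(i := v)) + f (z(i := v')) = b"
  shows "f (w(i := v')) = f (w(i := v)) + b"
proof -
  have "i \<in> I"
    using assms(1) coordinates(1) by blast
  have "\<not> outside b (f (w(i := v)) + f (w(i := v')))"
    using semilinear_line [OF assms(1,2)] assms(3) by simp
  moreover have "v \<noteq> v'"
    using assms(3) label by auto
  then have "f (w(i := v')) \<noteq> f (w(i := v))"
    using line_eq_iff [OF \<open>i \<in> I\<close>, of w v' v] by simp
  ultimately show ?thesis
    using not_outside_add_cases by blast
qed

lemma semilinear_parity:
  assumes "F \<subseteq> E" "x \<in> face E z" "y \<in> face F x"
    and "\<And>i. i \<in> F \<Longrightarrow> outside b (f (z(i := x i)) + f (z(i := y i))) = P"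
  shows "outside b (f x + f y) = (odd (card F) \<and> P)"
proof -
  have "outside b (f x + f (override_on x y A)) = (odd (card A) \<and> P)" if "A \<subseteq> F" for A
    using finite_subset [OF subset_trans [OF that assms(1)] coordinates(2)] that
  proof (induction A rule: finite_induct)
    case (insert i A)
    let ?w = "override_on x y A"
    have "i \<in> E" "i \<in> F" "?w \<in> face E z" "?w(i := x i) = ?w"
      using insert.prems insert.hyps(2) assms(1,2) by (auto simp: face_override_on fun_upd_idem)
    then have "outside b (f ?w + f (override_on x y (insert i A))) = P"
      unfolding override_on_insert using semilinear_line [of i ?w "x i" "y i"] assms(4) by metis
    then show ?case
      using insert outside_add [OF label, of "f x + f ?w" "f ?w + f (override_on x y (insert i A))"]
      by (auto simp: add.assoc)
  qed simp
  from this [of F] show ?thesis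
    using override_on_face [OF assms(3)] by simp
qed

lemma semilinear_shift_label:
  assumes "F \<subseteq> E" "x \<in> face E z" "y \<in> face F x"
    and "\<And>i. i \<in> F \<Longrightarrow> f (z(i := x i)) + f (z(i := y i)) = b"
  shows "f y = f x + (if odd (card F) then b else 0)"
proof -
  have "f (override_on x y A) = f x + (if odd (card A) then b else 0)" if "A \<subseteq> F" for A
    using finite_subset [OF subset_trans [OF that assms(1)] coordinates(2)] that
  proof (induction A rule: finite_induct)
    case (insert i A)
    let ?w = "override_on x y A"
    have "i \<in> E" "i \<in> F" "?w \<in> face E z" "?w(i := x i) = ?w"
      using insert.prems insert.hyps(2) assms(1,2) by (auto simp: face_override_on fun_upd_idem)
    then have "f (override_on x y (insert i A)) = f ?w + b"
      unfolding override_on_insert using semilinear_line_label [of i ?w "x i" "y i"] assms(4)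
      by metis
    then show ?case
      using insert by (simp add: ac_simps)
  qed simp
  from this [of F] show ?thesis
    using override_on_face [OF assms(3)] by simp
qed

definition sheared_lines :: "'i \<Rightarrow> (klein4 \<Rightarrow> klein4) set" where
  "sheared_lines i = range (\<lambda>p u. move_val i (shear b p u) z)"

lemma card_sheared_lines: "i \<in> I \<Longrightarrow> card (sheared_lines i) = 8"
proof -
  assume "i \<in> I"
  then have "inj (\<lambda>p u. move_val i (shear b p u) z)"
    using inj_shear [OF label] by (auto simp: inj_def fun_eq_iff move_val_eq_iff)
  then have "card (sheared_lines i) = card (UNIV :: (klein4 \<times> bool) set)"
    unfolding sheared_lines_def by (rule card_image)
  then show ?thesis
    by (simp add: card_klein4 flip: UNIV_Times_UNIV)
qed

lemma bij_sheared_line: "i \<in> I \<Longrightarrow> s \<in> sheared_lines i \<Longrightarrow> bij s"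
  using inj_shear_apply [OF label]
  by (intro bij_finiteI) (auto simp: sheared_lines_def inj_def move_val_eq_iff)

lemma sheared_line_increment:
  assumes "i \<in> I" "s \<in> sheared_lines i"
  shows "outside b (f (z(i := s t)) + f (z(i := s t'))) = outside b (t + t')"
    "f (z(i := s t)) + f (z(i := s (t + b))) = b"
proof -
  obtain p where "s = (\<lambda>u. move_val i (shear b p u) z)"
    using assms(2) by (auto simp: sheared_lines_def)
  then have increment: "f (z(i := s t)) + f (z(i := s u)) = shear b p t + shear b p u" for u
    using assms(1) by (simp add: ac_simps)
  show "outside b (f (z(i := s t)) + f (z(i := s t'))) = outside b (t + t')"
    unfolding increment by (rule outside_shear [OF label])
  show "f (z(i := s t)) + f (z(i := s (t + b))) = b"
    unfolding increment by (simp add: shear_add_label [OF label])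
qed

lemma bij_completion_sheared_lines:
  assumes "k \<in> E" "odd (card E)" "r \<in> PiE (E - {k}) sheared_lines"
  shows "bij (\<lambda>t. solve k t (override_on z (\<lambda>i. r i t) (E - {k})))"
proof (rule bij_finiteI, rule injI)
  let ?F = "E - {k}"
  define point where "point t = override_on z (\<lambda>i. r i t) ?F" for t
  fix t t'
  assume "solve k t (override_on z (\<lambda>i. r i t) ?F) = solve k t' (override_on z (\<lambda>i. r i t') ?F)"
  then have eq: "solve k t (point t) = solve k t' (point t')"
    by (simp add: point_def)
  define x where "x = (point t)(k := solve k t (point t))"
  define y where "y = (point t')(k := solve k t (point t))"
  have "k \<in> I"
    using assms(1) coordinates(1) by blast
  then have f: "f x = t" "f y = t'"
    by (simp add: x_def, simp add: y_def eq)
  have face: "x \<in> face E z" "y \<in> face ?F x"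
    using assms(1) by (auto simp: x_def y_def point_def face_def)
  have coordinate: "x i = r i t" "y i = r i t'" "i \<in> I" "r i \<in> sheared_lines i" if "i \<in> ?F" for i
    using that assms(3) coordinates(1) by (auto simp: x_def y_def point_def)
  have even: "even (card ?F)"
    using assms(1,2) coordinates(2) by simp
  have "outside b (f x + f y) = (odd (card ?F) \<and> outside b (t + t'))"
    using face coordinate sheared_line_increment(1) by (intro semilinear_parity) auto
  then have "t' = t \<or> t' = t + b"
    using even f not_outside_add_cases by simp
  moreover have "f y = f x" if "t' = t + b"
    using semilinear_shift_label [OF _ face] coordinate sheared_line_increment(2) even that by auto
  ultimately show "t = t'"
    using f by metis
qed

theorem card_transversal_maps_semilinear:
  assumes "odd (card E)"
  shows "8 ^ (card E - 1) \<le> card (transversal_maps f E z)"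
proof -
  obtain k where k: "k \<in> E"
    using assms by fastforce
  let ?R = "PiE (E - {k}) sheared_lines"
  have "card ?R = 8 ^ (card E - 1)"
    using coordinates k card_sheared_lines by (simp add: card_PiE subset_iff)
  moreover have "?R \<subseteq> (E - {k}) \<rightarrow>\<^sub>E {s. bij s}"
    using coordinates(1) bij_sheared_line by (intro PiE_mono) blast
  then have "card ?R \<le> card (transversal_maps f E z)"
    using coordinates k bij_completion_sheared_lines [OF k assms]
    by (intro card_transversal_maps_ge_completable) auto
  ultimately show ?thesis by simp
qed

end

section \<open>The lower bound\<close>

lemma power_le_card_splits_product:
  assumes "E \<subseteq> I" "finite E" "W \<subseteq> E" "splits f E z W" "k \<in> W"
    and "8 ^ (card W - 1) \<le> card (transversal_maps f W z)"
    and "8 ^ card (E - W) \<le> card (transversal_maps f (insert k (E - W)) z)"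
  shows "8 ^ (card E - 1) \<le> card (transversal_maps f E z)"
proof -
  have "finite W"
    using assms(2,3) by (rule rev_finite_subset)
  then have "card W \<noteq> 0"
    using assms(5) by auto
  then have "card E - 1 = (card W - 1) + card (E - W)"
    using card_Diff_subset [OF \<open>finite W\<close> assms(3)] card_mono [OF assms(2,3)] by linarith
  then have "(8 :: nat) ^ (card E - 1) = 8 ^ (card W - 1) * 8 ^ card (E - W)"
    by (simp only: power_add)
  also have "\<dots> \<le> card (transversal_maps f W z) * card (transversal_maps f (insert k (E - W)) z)"
    using assms(6,7) by (rule mult_le_mono)
  also have "\<dots> \<le> card (transversal_maps f E z)"
    using assms(1-5) by (intro card_transversal_maps_splits_product) auto
  finally show ?thesis .
qed

lemma power_le_card_splits_const:
  assumes "E \<subseteq> I" "finite E" "W \<subseteq> E" "splits f E z W" "k \<in> W" "2 \<le> card W" "W \<noteq> E"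
    and "\<And>u. 8 ^ (card W - 2) \<le> card (transversal_maps (solve k u) (W - {k}) z)"
    and "\<And>y. 8 ^ (card (E - W) - 1) \<le> card (transversal_maps f (E - W) y)"
  shows "8 ^ (card E - 1) \<le> card (transversal_maps f E z)"
proof -
  let ?m = "8 ^ (card W - 2) :: nat" and ?n = "8 ^ (card (E - W) - 1) :: nat"
  have "finite W"
    using assms(2,3) by (rule rev_finite_subset)
  have "card (E - W) \<noteq> 0"
    using assms(2,3,7) by auto
  then have "card E - 1 = 2 + (card W - 2) + (card (E - W) - 1)"
    using card_Diff_subset [OF \<open>finite W\<close> assms(3)] card_mono [OF assms(2,3)] assms(6) by linarith
  then have "(8 :: nat) ^ (card E - 1) = 64 * (?m * ?n)"
    by (simp only: power_add) simp
  also have "\<dots> \<le> 4 * (fact 4 * ?m * ?n)"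
    by (simp add: fact_numeral)
  also have "\<dots> \<le> card (transversal_maps f E z)"
    using card_transversal_maps_splits_const [OF assms(2,3) _ assms(4,5,8,9)] assms(1,3)
    by (simp add: card_klein4)
  finally show ?thesis .
qed

lemma power_le_card_splits:
  assumes "finite I" "odd (card I)" and split: "W \<subseteq> I" "W \<noteq> I" "2 \<le> card W" "splits f I z W"
    and smaller: "\<And>(g :: ('i \<Rightarrow> klein4) \<Rightarrow> klein4) E y. card E < card I \<Longrightarrow> latin g E \<Longrightarrow> finite E \<Longrightarrow>
      odd (card E) \<Longrightarrow> 8 ^ (card E - 1) \<le> card (transversal_maps g E y)"
  shows "8 ^ (card I - 1) \<le> card (transversal_maps f I z)"
proof -
  obtain k where k: "k \<in> W"
    using split(3) by fastforce
  have fin: "finite W" "finite (I - W)"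
    using split(1) assms(1) finite_subset by auto
  have card: "card I = card W + card (I - W)" "card (I - W) \<noteq> 0"
    using split(1,2) fin card_Diff_subset [OF fin(1) split(1)] card_mono [OF assms(1) split(1)]
    by (linarith, auto)
  show ?thesis
  proof (cases "odd (card W)")
    case True
    have "8 ^ (card W - 1) \<le> card (transversal_maps f W z)"
      using True split(1) fin card by (intro smaller latin_subset) auto
    moreover have "8 ^ (card (insert k (I - W)) - 1) \<le> card (transversal_maps f (insert k (I - W)) z)"
      using True split(1,3) fin card k assms(2) by (intro smaller latin_subset) auto
    ultimately show ?thesis
      using split k fin assms(1) by (intro power_le_card_splits_product [of I W z k]) auto
  next
    case False
    have "8 ^ (card (W - {k}) - 1) \<le> card (transversal_maps (solve k u) (W - {k}) z)" for u
      using False split(1,3) fin card k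
      by (intro smaller latin.latin_subset [OF latin_solve]) auto
    moreover have "card (W - {k}) - 1 = card W - 2"
      using k by simp
    moreover have "8 ^ (card (I - W) - 1) \<le> card (transversal_maps f (I - W) y)" for y
      using False split(1,3) fin card assms(2) by (intro smaller latin_subset) auto
    ultimately show ?thesis
      by (intro power_le_card_splits_const [OF subset_refl assms(1) split(1,4) k split(3,2)]) simp_all
  qed
qed

end

theorem card_transversal_maps_ge:
  fixes f :: "('i \<Rightarrow> klein4) \<Rightarrow> klein4"
  assumes "latin f E" "finite E" "odd (card E)"
  shows "8 ^ (card E - 1) \<le> card (transversal_maps f E z)"
  using assms
proof (induction "card E" arbitrary: f E z rule: less_induct)
  case (less E f z)
  interpret latin4 f E
    using less.prems(1) by (rule latin4.intro)
  show ?case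
  proof (cases "card E = 1")
    case True
    then obtain i where "E = {i}"
      using card_1_singletonE by blast
    then have "semilinear K1 E z"
      by (auto simp: semilinear_def face_edge_def colour_edge_def)
    then show ?thesis
      using less.prems
      by (intro card_transversal_maps_semilinear [of K1]) (auto simp: zero_klein4_def)
  next
    case False
    then have "2 \<le> card E"
      using less.prems(3) by (cases "card E") auto
    with subset_refl [of E] \<open>finite E\<close> show ?thesis
    proof (cases rule: semilinear_or_splits [where z = z])
      case (semilinear b)
      then show ?thesis
        using less.prems by (intro card_transversal_maps_semilinear [of b]) auto
    next
      case (split W)
      then show ?thesis
        using less.hyps by (rule power_le_card_splits [OF less.prems(2,3)])
    qed
  qed
qed

section \<open>Quasigroups on lists\<close>

locale coded_quasigroup =
  fixes q n :: nat and f :: "nat list \<Rightarrow> nat" and code :: "'v::finite \<Rightarrow> nat"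
  assumes quasigroup: "quasigroup q n f"
    and bij_code: "bij_betw code UNIV {0..<q}"
begin

definition word :: "(nat \<Rightarrow> 'v) \<Rightarrow> nat list" where
  "word x = map (\<lambda>i. code (x i)) [0..<n]"

definition decoded :: "(nat \<Rightarrow> 'v) \<Rightarrow> 'v" where
  "decoded x = inv code (f (word x))"

definition transversal_of :: "(nat \<Rightarrow> 'v \<Rightarrow> 'v) \<Rightarrow> nat list set" where
  "transversal_of \<sigma> = range (\<lambda>t. code t # word (\<lambda>i. \<sigma> i t))"

lemma code_eq_iff [simp]: "code u = code v \<longleftrightarrow> u = v"
  using bij_code by (auto simp: bij_betw_def inj_eq)

lemma code_less [simp]: "code v < q"
  using bij_code by (auto simp: bij_betw_def)

lemma code_inv [simp]: "k < q \<Longrightarrow> code (inv code k) = k"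
  using bij_code by (simp add: bij_betw_def f_inv_into_f)

lemma nth_word [simp]: "i < n \<Longrightarrow> word x ! i = code (x i)"
  by (simp add: word_def)

lemma word_in_words: "word x \<in> words q n"
  by (auto simp: words_def word_def)

lemma word_upd: "word (x(i := v)) = (word x)[i := code v]"
  by (rule nth_equalityI) (auto simp: word_def nth_list_update)

lemma word_eq_iff: "word x = word y \<longleftrightarrow> (\<forall>i<n. x i = y i)"
  by (auto simp: word_def)

lemma code_decoded: "code (decoded x) = f (word x)"
  using quasigroup word_in_words [of x] by (auto simp: decoded_def quasigroup_def)

lemma latin_decoded: "latin decoded {0..<n}"
proof
  fix i x assume "i \<in> {0..<n}"
  then have i: "Suc i \<in> {0..n}" by simp
  show "bij (\<lambda>v. decoded (x(i := v)))"
  proof (rule bij_finiteI, rule injI)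
    fix v v' assume eq: "decoded (x(i := v)) = decoded (x(i := v'))"
    let ?\<alpha> = "code (decoded (x(i := v))) # word x"
    have "?\<alpha> \<in> words q (n + 1)"
      using word_in_words [of x] by (auto simp: words_def)
    then have "\<exists>!t. t \<in> {0..<q} \<and> graph_vector f (?\<alpha>[Suc i := t])"
      using quasigroup i unfolding quasigroup_def by blast
    moreover have "graph_vector f (?\<alpha>[Suc i := code u])"
      if "decoded (x(i := u)) = decoded (x(i := v))" for u
      using code_decoded [of "x(i := u)"] by (simp add: that graph_vector_def word_upd)
    ultimately have "code v = code v'"
      using eq by (metis atLeastLessThan_iff code_less zero_le)
    then show "v = v'" by simp
  qed
qed

lemma transversal_transversal_of:
  assumes "\<sigma> \<in> transversal_maps decoded {0..<n} z"
  shows "transversal q n f (transversal_of \<sigma>)"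
proof -
  have "f (word (\<lambda>i. \<sigma> i t)) = code t" for t
  proof -
    have "word (override_on z (\<lambda>i. \<sigma> i t) {0..<n}) = word (\<lambda>i. \<sigma> i t)"
      by (simp add: word_eq_iff)
    then show ?thesis
      using bij_familiesD(3) [OF assms, of t] code_decoded by (metis id_apply)
  qed
  then have "\<forall>\<alpha>\<in>transversal_of \<sigma>. graph_vector f \<alpha>"
    by (auto simp: transversal_of_def graph_vector_def)
  moreover have "transversal_of \<sigma> \<subseteq> words q (n + 1)"
    by (auto simp: transversal_of_def words_def word_def)
  moreover have "card (transversal_of \<sigma>) = q"
    using bij_betw_same_card [OF bij_code] unfolding transversal_of_def
    by (subst card_image) (auto simp: inj_def)
  moreover have "(code t # word (\<lambda>i. \<sigma> i t)) ! k \<noteq> (code u # word (\<lambda>i. \<sigma> i u)) ! k"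
    if "t \<noteq> u" "k \<le> n" for t u k
  proof (cases k)
    case (Suc i)
    then have "bij (\<sigma> i)"
      using bij_familiesD(2) [OF assms, of i] that by simp
    then show ?thesis
      using Suc that by (auto simp: bij_def inj_eq)
  qed (use that in simp)
  ultimately show ?thesis
    unfolding transversal_def by (auto simp: transversal_of_def)
qed

lemma inj_on_transversal_of: "inj_on transversal_of (transversal_maps decoded {0..<n} z)"
proof (rule inj_onI)
  fix \<sigma> \<tau>
  assume maps: "\<sigma> \<in> transversal_maps decoded {0..<n} z" "\<tau> \<in> transversal_maps decoded {0..<n} z"
    and eq: "transversal_of \<sigma> = transversal_of \<tau>"
  have "\<sigma> i t = \<tau> i t" if "i < n" for i t
  proof -
    have "code t # word (\<lambda>i. \<sigma> i t) \<in> transversal_of \<tau>"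
      unfolding eq [symmetric] by (simp add: transversal_of_def)
    then have "word (\<lambda>i. \<sigma> i t) = word (\<lambda>i. \<tau> i t)"
      by (auto simp: transversal_of_def)
    then show ?thesis
      using that by (simp add: word_eq_iff)
  qed
  then show "\<sigma> = \<tau>"
    by (intro bij_families_eqI [OF maps]) auto
qed

lemma finite_transversals: "finite {T. transversal q n f T}"
proof (rule finite_subset)
  show "{T. transversal q n f T} \<subseteq> Pow (words q (n + 1))"
    by (auto simp: transversal_def)
  have "words q (n + 1) = {xs. set xs \<subseteq> {0..<q} \<and> length xs = n + 1}"
    by (auto simp: words_def)
  then show "finite (Pow (words q (n + 1)))"
    by (simp add: finite_lists_length_eq)
qed

theorem card_transversal_maps_le:
  "card (transversal_maps decoded {0..<n} z) \<le> card {T. transversal q n f T}"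
  using transversal_transversal_of
  by (intro card_inj_on_le [OF inj_on_transversal_of _ finite_transversals]) blast

end

theorem theorem8:
  fixes n :: nat and f :: "nat list \<Rightarrow> nat"
  assumes "odd n" and "quasigroup 4 n f"
  shows "card {T. transversal 4 n f T} \<ge> 8 ^ (n - 1)"
proof -
  obtain code :: "klein4 \<Rightarrow> nat" where "bij_betw code UNIV {0..<4}"
    using finite_same_card_bij [of "UNIV :: klein4 set" "{0..<4 :: nat}"]
    by (auto simp: card_klein4)
  then interpret coded_quasigroup 4 n f code
    using assms(2) by unfold_locales
  have "8 ^ (n - 1) \<le> card (transversal_maps decoded {0..<n} (\<lambda>_. 0))"
    using card_transversal_maps_ge [OF latin_decoded] assms(1) by simp
  also have "\<dots> \<le> card {T. transversal 4 n f T}"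
    by (rule card_transversal_maps_le)
  finally show ?thesis .
qed

end
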